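(* Let $M$ be a smooth manifold equipped with the $0$ Poisson bracket. Then there is a faithful strict quantization $\{\mathcal{A}_{\hbar},\pi_{\hbar}\}_{\hbar\in I}$ of $M$ over $I=[0,1]$ with $A=C^{\infty}_c(M)$ such that it is impossible to restrict the maps $\pi_{\hbar}$ to a dense $*$-subalgebra $B\subseteq A$ to get a strict deformation quantization of $M$.
   Context: For a locally compact Hausdorff space $X$, $C_{\infty}(X)$ denotes the $C^*$-algebra of $\mathbb{C}$-valued continuous functions on $X$ vanishing at infinity. $C^{\infty}_c(M)$ denotes the $*$-algebra of compactly supported $\mathbb{C}$-valued smooth functions on $M$. Strict deformation quantization: Let $M$ be a Poisson manifold (manifolds are nonempty) with Poisson bracket $\{\cdot,\cdot\}$. A strict deformation quantization of $M$ over $I$ consists of a dense $*$-subalgebra $A$ of $C_{\infty}(M)$ closed under the Poisson bracket, together with a continuous field of $C^*$-algebras $(\mathcal{A}_{\hbar})_{\hbar\in I}$ (in the sense of Dixmier) over a closed subset $I$ of the real line containing $0$ as a non-isolated point, and linear maps $\pi_{\hbar}:A\to\mathcal{A}_{\hbar}$ for each $\hbar\in I$, such that: (1) $\mathcal{A}_0=C_{\infty}(M)$ and $\pi_0$ is the canonical inclusion of $A$ into $C_{\infty}(M)$; (2) the section $(\pi_{\hbar}(f))_{\hbar\in I}$ is continuous for every $f\in A$; (3) for all $f,g\in A$, $\lim_{\hbar\to 0}\|[\pi_{\hbar}(f),\pi_{\hbar}(g)]/(i\hbar)-\pi_{\hbar}(\{f,g\})\|=0$; (4) $\pi_{\hbar}$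 is injective and $\pi_{\hbar}(A)$ is a dense $*$-subalgebra of $\mathcal{A}_{\hbar}$ for every $\hbar\in I$. A strict quantization of $M$ is defined in the same way, but without requiring condition (4). A strict quantization is faithful if $\pi_{\hbar}$ is injective for each $\hbar\in I$. Restricting to $B$: this means taking a dense $*$-subalgebra $B$ of $C_\infty(M)$ contained in $A$ and considering $B$ with the restricted maps $\pi_{\hbar}|_B$ in place of $A$ and $\pi_{\hbar}$. *)

theory Defs
  imports "HOL-Analysis.Analysis"
begin

section \<open>Smooth functions on open subsets of Euclidean n-space\<close>

text \<open>
  Points of Euclidean n-space are functions \<open>nat \<Rightarrow> real\<close> vanishing from index n on, as in
  \<^const>\<open>Euclidean_space\<close>; this keeps the dimension n an ordinary natural number and allows n = 0.
  \<open>Ck_on n k U f\<close> says that all partial derivatives of f of order at most k exist and are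
  continuous on the open set U.
\<close>

primrec Ck_on ::
  "nat \<Rightarrow> nat \<Rightarrow> (nat \<Rightarrow> real) set \<Rightarrow> ((nat \<Rightarrow> real) \<Rightarrow> 'v::real_normed_vector) \<Rightarrow> bool" where
  "Ck_on n 0 U f \<longleftrightarrow> continuous_map (subtopology (Euclidean_space n) U) euclidean f"
| "Ck_on n (Suc k) U f \<longleftrightarrow>
     continuous_map (subtopology (Euclidean_space n) U) euclidean f \<and>
     (\<forall>i<n. \<exists>g. (\<forall>x\<in>U. ((\<lambda>t. f (x(i := t))) has_vector_derivative g x) (at (x i))) \<and>
                Ck_on n k U g)"

definition Cinf_on ::
  "nat \<Rightarrow> (nat \<Rightarrow> real) set \<Rightarrow> ((nat \<Rightarrow> real) \<Rightarrow> 'v::real_normed_vector) \<Rightarrow> bool" where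
  "Cinf_on n U f \<longleftrightarrow> (\<forall>k. Ck_on n k U f)"


section \<open>Smooth manifolds\<close>

text \<open>
  The smooth structure is given by an atlas, not necessarily maximal. A chart is a pair of its
  domain and its coordinate map.
\<close>

type_synonym 'm chart = "'m set \<times> ('m \<Rightarrow> nat \<Rightarrow> real)"

locale smooth_manifold =
  fixes n :: nat and X :: "'m topology" and At :: "'m chart set"
  assumes nonempty: "topspace X \<noteq> {}"
    and Hausdorff: "Hausdorff_space X"
    and second_countable: "second_countable X"
    and chart_domain: "(U, \<phi>) \<in> At \<Longrightarrow> openin X U"
    and chart_image: "(U, \<phi>) \<in> At \<Longrightarrow> openin (Euclidean_space n) (\<phi> ` U)"
    and chart_homeo: "(U, \<phi>) \<in> At \<Longrightarrow>
      homeomorphic_map (subtopology X U) (subtopology (Euclidean_space n) (\<phi> ` U)) \<phi>"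
    and charts_cover: "(\<Union>(U, \<phi>)\<in>At. U) = topspace X"
    and charts_compatible: "\<lbrakk>(U, \<phi>) \<in> At; (V, \<psi>) \<in> At; j < n\<rbrakk> \<Longrightarrow>
      Cinf_on n (\<phi> ` (U \<inter> V)) (\<lambda>x. \<psi> (inv_into U \<phi> x) j)"

text \<open>
  A function on the manifold is represented by its extension by 0 to the whole type, so that
  equality of functions on the manifold is equality in HOL.
\<close>

definition Cinf :: "nat \<Rightarrow> 'm topology \<Rightarrow> 'm chart set \<Rightarrow> ('m \<Rightarrow> complex) set" where
  "Cinf n X At = {f. (\<forall>x. x \<notin> topspace X \<longrightarrow> f x = 0) \<and>
     (\<forall>(U, \<phi>)\<in>At. Cinf_on n (\<phi> ` U) (\<lambda>x. f (inv_into U \<phi> x)))}"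

definition Cinf_c :: "nat \<Rightarrow> 'm topology \<Rightarrow> 'm chart set \<Rightarrow> ('m \<Rightarrow> complex) set" where
  "Cinf_c n X At =
     {f \<in> Cinf n X At. compactin X (X closure_of {x \<in> topspace X. f x \<noteq> 0})}"

text \<open>
  A Poisson bracket on the complex-valued smooth functions: the complex-bilinear extension of a
  bracket on the real-valued ones, which is what compatibility with \<^const>\<open>cnj\<close> expresses.
\<close>

locale poisson_manifold = smooth_manifold n X At
  for n :: nat and X :: "'m topology" and At :: "'m chart set" +
  fixes bracket :: "('m \<Rightarrow> complex) \<Rightarrow> ('m \<Rightarrow> complex) \<Rightarrow> ('m \<Rightarrow> complex)"
  assumes bracket_closed:
      "\<lbrakk>f \<in> Cinf n X At; g \<in> Cinf n X At\<rbrakk> \<Longrightarrow> bracket f g \<in> Cinf n X At"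
    and bracket_add:
      "\<lbrakk>f \<in> Cinf n X At; g \<in> Cinf n X At; h \<in> Cinf n X At\<rbrakk> \<Longrightarrow>
        bracket (\<lambda>x. f x + g x) h = (\<lambda>x. bracket f h x + bracket g h x)"
    and bracket_scale:
      "\<lbrakk>f \<in> Cinf n X At; g \<in> Cinf n X At\<rbrakk> \<Longrightarrow>
        bracket (\<lambda>x. c * f x) g = (\<lambda>x. c * bracket f g x)"
    and bracket_antisym:
      "\<lbrakk>f \<in> Cinf n X At; g \<in> Cinf n X At\<rbrakk> \<Longrightarrow> bracket g f = (\<lambda>x. - bracket f g x)"
    and bracket_real:
      "\<lbrakk>f \<in> Cinf n X At; g \<in> Cinf n X At\<rbrakk> \<Longrightarrow>
        bracket (\<lambda>x. cnj (f x)) (\<lambda>x. cnj (g x)) = (\<lambda>x. cnj (bracket f g x))"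
    and bracket_Leibniz:
      "\<lbrakk>f \<in> Cinf n X At; g \<in> Cinf n X At; h \<in> Cinf n X At\<rbrakk> \<Longrightarrow>
        bracket f (\<lambda>x. g x * h x) = (\<lambda>x. bracket f g x * h x + g x * bracket f h x)"
    and bracket_Jacobi:
      "\<lbrakk>f \<in> Cinf n X At; g \<in> Cinf n X At; h \<in> Cinf n X At\<rbrakk> \<Longrightarrow>
        (\<lambda>x. bracket f (bracket g h) x + bracket g (bracket h f) x + bracket h (bracket f g) x)
          = (\<lambda>x. 0)"


section \<open>C*-algebras\<close>

text \<open>
  Algebras are not required to have a unit. A record with a carrier is used because the fibres of
  a continuous field are different algebras with elements in one type.
\<close>

record 'b cstar =
  car :: "'b set"
  zer :: 'b  (\<open>\<zero>\<index>\<close>)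
  add :: "'b \<Rightarrow> 'b \<Rightarrow> 'b"  (infixl \<open>\<oplus>\<index>\<close> 65)
  scl :: "complex \<Rightarrow> 'b \<Rightarrow> 'b"  (infixr \<open>\<odot>\<index>\<close> 75)
  mul :: "'b \<Rightarrow> 'b \<Rightarrow> 'b"  (infixl \<open>\<otimes>\<index>\<close> 70)
  adj :: "'b \<Rightarrow> 'b"
  nrm :: "'b \<Rightarrow> real"

definition sub :: "'b cstar \<Rightarrow> 'b \<Rightarrow> 'b \<Rightarrow> 'b"  (infixl \<open>\<ominus>\<index>\<close> 65) where
  "x \<ominus>\<^bsub>A\<^esub> y = x \<oplus>\<^bsub>A\<^esub> ((-1) \<odot>\<^bsub>A\<^esub> y)"

locale cstar_algebra =
  fixes A :: "'b cstar" (structure)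
  assumes zer_closed: "\<zero> \<in> car A"
    and add_closed: "\<lbrakk>x \<in> car A; y \<in> car A\<rbrakk> \<Longrightarrow> x \<oplus> y \<in> car A"
    and scl_closed: "x \<in> car A \<Longrightarrow> c \<odot> x \<in> car A"
    and mul_closed: "\<lbrakk>x \<in> car A; y \<in> car A\<rbrakk> \<Longrightarrow> x \<otimes> y \<in> car A"
    and adj_closed: "x \<in> car A \<Longrightarrow> adj A x \<in> car A"
    and add_assoc: "\<lbrakk>x \<in> car A; y \<in> car A; z \<in> car A\<rbrakk> \<Longrightarrow> (x \<oplus> y) \<oplus> z = x \<oplus> (y \<oplus> z)"
    and add_comm: "\<lbrakk>x \<in> car A; y \<in> car A\<rbrakk> \<Longrightarrow> x \<oplus> y = y \<oplus> x"
    and zer_add: "x \<in> car A \<Longrightarrow> \<zero> \<oplus> x = x"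
    and sub_self: "x \<in> car A \<Longrightarrow> x \<ominus> x = \<zero>"
    and scl_add_right: "\<lbrakk>x \<in> car A; y \<in> car A\<rbrakk> \<Longrightarrow> c \<odot> (x \<oplus> y) = c \<odot> x \<oplus> c \<odot> y"
    and scl_add_left: "x \<in> car A \<Longrightarrow> (c + d) \<odot> x = c \<odot> x \<oplus> d \<odot> x"
    and scl_scl: "x \<in> car A \<Longrightarrow> (c * d) \<odot> x = c \<odot> (d \<odot> x)"
    and scl_one: "x \<in> car A \<Longrightarrow> 1 \<odot> x = x"
    and mul_assoc: "\<lbrakk>x \<in> car A; y \<in> car A; z \<in> car A\<rbrakk> \<Longrightarrow> (x \<otimes> y) \<otimes> z = x \<otimes> (y \<otimes> z)"
    and mul_add_right: "\<lbrakk>x \<in> car A; y \<in> car A; z \<in> car A\<rbrakk> \<Longrightarrow> x \<otimes> (y \<oplus> z) = x \<otimes> y \<oplus> x \<otimes> z"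
    and mul_add_left: "\<lbrakk>x \<in> car A; y \<in> car A; z \<in> car A\<rbrakk> \<Longrightarrow> (x \<oplus> y) \<otimes> z = x \<otimes> z \<oplus> y \<otimes> z"
    and mul_scl_left: "\<lbrakk>x \<in> car A; y \<in> car A\<rbrakk> \<Longrightarrow> (c \<odot> x) \<otimes> y = c \<odot> (x \<otimes> y)"
    and mul_scl_right: "\<lbrakk>x \<in> car A; y \<in> car A\<rbrakk> \<Longrightarrow> x \<otimes> (c \<odot> y) = c \<odot> (x \<otimes> y)"
    and adj_add: "\<lbrakk>x \<in> car A; y \<in> car A\<rbrakk> \<Longrightarrow> adj A (x \<oplus> y) = adj A x \<oplus> adj A y"
    and adj_scl: "x \<in> car A \<Longrightarrow> adj A (c \<odot> x) = cnj c \<odot> adj A x"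
    and adj_mul: "\<lbrakk>x \<in> car A; y \<in> car A\<rbrakk> \<Longrightarrow> adj A (x \<otimes> y) = adj A y \<otimes> adj A x"
    and adj_adj: "x \<in> car A \<Longrightarrow> adj A (adj A x) = x"
    and nrm_nonneg: "x \<in> car A \<Longrightarrow> 0 \<le> nrm A x"
    and nrm_eq_0: "x \<in> car A \<Longrightarrow> nrm A x = 0 \<longleftrightarrow> x = \<zero>"
    and nrm_triangle: "\<lbrakk>x \<in> car A; y \<in> car A\<rbrakk> \<Longrightarrow> nrm A (x \<oplus> y) \<le> nrm A x + nrm A y"
    and nrm_scl: "x \<in> car A \<Longrightarrow> nrm A (c \<odot> x) = cmod c * nrm A x"
    and nrm_mul: "\<lbrakk>x \<in> car A; y \<in> car A\<rbrakk> \<Longrightarrow> nrm A (x \<otimes> y) \<le> nrm A x * nrm A y"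
    and cstar_identity: "x \<in> car A \<Longrightarrow> nrm A (adj A x \<otimes> x) = (nrm A x)\<^sup>2"
    and complete: "Metric_space.mcomplete (car A) (\<lambda>x y. nrm A (x \<ominus> y))"

definition dense_in :: "'b cstar \<Rightarrow> 'b set \<Rightarrow> bool" where
  "dense_in A S \<longleftrightarrow> S \<subseteq> car A \<and> (\<forall>x\<in>car A. \<forall>\<epsilon>>0. \<exists>s\<in>S. nrm A (x \<ominus>\<^bsub>A\<^esub> s) < \<epsilon>)"

definition star_subalgebra :: "'b cstar \<Rightarrow> 'b set \<Rightarrow> bool" where
  "star_subalgebra A S \<longleftrightarrow> S \<subseteq> car A \<and> \<zero>\<^bsub>A\<^esub> \<in> S \<and>
     (\<forall>x\<in>S. \<forall>y\<in>S. x \<oplus>\<^bsub>A\<^esub> y \<in> S) \<and>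
     (\<forall>c. \<forall>x\<in>S. c \<odot>\<^bsub>A\<^esub> x \<in> S) \<and>
     (\<forall>x\<in>S. \<forall>y\<in>S. x \<otimes>\<^bsub>A\<^esub> y \<in> S) \<and>
     (\<forall>x\<in>S. adj A x \<in> S)"

definition dense_star_subalgebra :: "'b cstar \<Rightarrow> 'b set \<Rightarrow> bool" where
  "dense_star_subalgebra A S \<longleftrightarrow> star_subalgebra A S \<and> dense_in A S"

definition cstar_iso :: "'b cstar \<Rightarrow> 'c cstar \<Rightarrow> ('b \<Rightarrow> 'c) \<Rightarrow> bool" where
  "cstar_iso A B \<iota> \<longleftrightarrow> bij_betw \<iota> (car A) (car B) \<and>
     (\<forall>x\<in>car A. \<forall>y\<in>car A. \<iota> (x \<oplus>\<^bsub>A\<^esub> y) = \<iota> x \<oplus>\<^bsub>B\<^esub> \<iota> y) \<and>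
     (\<forall>c. \<forall>x\<in>car A. \<iota> (c \<odot>\<^bsub>A\<^esub> x) = c \<odot>\<^bsub>B\<^esub> \<iota> x) \<and>
     (\<forall>x\<in>car A. \<forall>y\<in>car A. \<iota> (x \<otimes>\<^bsub>A\<^esub> y) = \<iota> x \<otimes>\<^bsub>B\<^esub> \<iota> y) \<and>
     (\<forall>x\<in>car A. \<iota> (adj A x) = adj B (\<iota> x)) \<and>
     (\<forall>x\<in>car A. nrm B (\<iota> x) = nrm A x)"

text \<open>The algebra of continuous functions vanishing at infinity, with the supremum norm.\<close>

definition C0 :: "'m topology \<Rightarrow> ('m \<Rightarrow> complex) cstar" where
  "C0 X = \<lparr>car = {f. (\<forall>x. x \<notin> topspace X \<longrightarrow> f x = 0) \<and> continuous_map X euclidean f \<and>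
              (\<forall>\<epsilon>>0. \<exists>K. compactin X K \<and> (\<forall>x\<in>topspace X - K. cmod (f x) < \<epsilon>))},
           zer = (\<lambda>x. 0),
           add = (\<lambda>f g x. f x + g x),
           scl = (\<lambda>c f x. c * f x),
           mul = (\<lambda>f g x. f x * g x),
           adj = (\<lambda>f x. cnj (f x)),
           nrm = (\<lambda>f. SUP x\<in>topspace X. cmod (f x))\<rparr>"


section \<open>Continuous fields of C*-algebras\<close>

text \<open>
  Dixmier's definition over a base T in the real line; \<open>\<Gamma>\<close> is the set of continuous sections.
  A section is a function on all reals of which only the values on T matter: by
  \<open>locally_approximable\<close>, \<open>\<Gamma>\<close> does not distinguish functions that agree on T.
\<close>

locale continuous_field =
  fixes T :: "real set" and \<A> :: "real \<Rightarrow> 'b cstar" and \<Gamma> :: "(real \<Rightarrow> 'b) set"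
  assumes fibre: "t \<in> T \<Longrightarrow> cstar_algebra (\<A> t)"
    and sections: "\<Gamma> \<subseteq> (\<Pi> t\<in>T. car (\<A> t))"
    and section_zer: "(\<lambda>t. \<zero>\<^bsub>\<A> t\<^esub>) \<in> \<Gamma>"
    and section_add: "\<lbrakk>x \<in> \<Gamma>; y \<in> \<Gamma>\<rbrakk> \<Longrightarrow> (\<lambda>t. x t \<oplus>\<^bsub>\<A> t\<^esub> y t) \<in> \<Gamma>"
    and section_scl: "x \<in> \<Gamma> \<Longrightarrow> (\<lambda>t. c \<odot>\<^bsub>\<A> t\<^esub> x t) \<in> \<Gamma>"
    and section_mul: "\<lbrakk>x \<in> \<Gamma>; y \<in> \<Gamma>\<rbrakk> \<Longrightarrow> (\<lambda>t. x t \<otimes>\<^bsub>\<A> t\<^esub> y t) \<in> \<Gamma>"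
    and section_adj: "x \<in> \<Gamma> \<Longrightarrow> (\<lambda>t. adj (\<A> t) (x t)) \<in> \<Gamma>"
    and sections_dense: "t \<in> T \<Longrightarrow> dense_in (\<A> t) ((\<lambda>x. x t) ` \<Gamma>)"
    and norm_continuous: "x \<in> \<Gamma> \<Longrightarrow> continuous_on T (\<lambda>t. nrm (\<A> t) (x t))"
    and locally_approximable:
      "\<lbrakk>x \<in> (\<Pi> t\<in>T. car (\<A> t));
        \<forall>t\<in>T. \<forall>\<epsilon>>0. \<exists>y\<in>\<Gamma>. \<exists>U. open U \<and> t \<in> U \<and>
          (\<forall>s\<in>U \<inter> T. nrm (\<A> s) (x s \<ominus>\<^bsub>\<A> s\<^esub> y s) \<le> \<epsilon>)\<rbrakk> \<Longrightarrow> x \<in> \<Gamma>"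


section \<open>Strict quantizations\<close>

text \<open>
  That \<open>A\<close> consists of smooth functions is implicit in its being closed under the Poisson bracket.
  The equality of the fibre at 0 with the algebra of functions is read as an isometric
  *-isomorphism \<open>\<iota>\<close>, which carries \<open>\<pi> 0\<close> to the inclusion of \<open>A\<close>.
\<close>

locale strict_quantization =
  poisson_manifold n X At bracket + continuous_field I \<A> \<Gamma>
  for n :: nat and X :: "'m topology" and At :: "'m chart set"
    and bracket :: "('m \<Rightarrow> complex) \<Rightarrow> ('m \<Rightarrow> complex) \<Rightarrow> ('m \<Rightarrow> complex)"
    and I :: "real set" and \<A> :: "real \<Rightarrow> 'b cstar" and \<Gamma> :: "(real \<Rightarrow> 'b) set" +
  fixes A :: "('m \<Rightarrow> complex) set" and \<pi> :: "real \<Rightarrow> ('m \<Rightarrow> complex) \<Rightarrow> 'b"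
  assumes base_closed: "closed I"
    and base_zero: "0 \<in> I"
    and base_zero_nonisolated: "0 islimpt I"
    and domain_dense: "dense_star_subalgebra (C0 X) A"
    and domain_smooth: "A \<subseteq> Cinf n X At"
    and domain_bracket: "\<lbrakk>f \<in> A; g \<in> A\<rbrakk> \<Longrightarrow> bracket f g \<in> A"
    and quant_closed: "\<lbrakk>h \<in> I; f \<in> A\<rbrakk> \<Longrightarrow> \<pi> h f \<in> car (\<A> h)"
    and quant_add: "\<lbrakk>h \<in> I; f \<in> A; g \<in> A\<rbrakk> \<Longrightarrow>
      \<pi> h (\<lambda>x. f x + g x) = \<pi> h f \<oplus>\<^bsub>\<A> h\<^esub> \<pi> h g"
    and quant_scale: "\<lbrakk>h \<in> I; f \<in> A\<rbrakk> \<Longrightarrow> \<pi> h (\<lambda>x. c * f x) = c \<odot>\<^bsub>\<A> h\<^esub> \<pi> h f"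
    and classical_fibre: "\<exists>\<iota>. cstar_iso (\<A> 0) (C0 X) \<iota> \<and> (\<forall>f\<in>A. \<iota> (\<pi> 0 f) = f)"
    and quant_continuous: "f \<in> A \<Longrightarrow> (\<lambda>h. \<pi> h f) \<in> \<Gamma>"
    and quant_commutator: "\<lbrakk>f \<in> A; g \<in> A\<rbrakk> \<Longrightarrow>
      ((\<lambda>h. nrm (\<A> h)
          ((1 / (\<i> * complex_of_real h)) \<odot>\<^bsub>\<A> h\<^esub>
             (\<pi> h f \<otimes>\<^bsub>\<A> h\<^esub> \<pi> h g \<ominus>\<^bsub>\<A> h\<^esub> \<pi> h g \<otimes>\<^bsub>\<A> h\<^esub> \<pi> h f)
           \<ominus>\<^bsub>\<A> h\<^esub> \<pi> h (bracket f g)))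
        \<longlongrightarrow> 0) (at 0 within I)"

locale faithful_strict_quantization = strict_quantization +
  assumes quant_inj: "h \<in> I \<Longrightarrow> inj_on (\<pi> h) A"

locale strict_deformation_quantization = strict_quantization +
  assumes quant_inj: "h \<in> I \<Longrightarrow> inj_on (\<pi> h) A"
    and quant_image: "h \<in> I \<Longrightarrow> dense_star_subalgebra (\<A> h) (\<pi> h ` A)"

end

theory Submission
  imports Defs
begin

text \<open>
  A strict quantization constrains how the images of functions behave in the limit, but nothing forces
  these images to fill the fibres.  So the fibres can be made too large.  Let the fibre over 0 be
  \<open>C\<^sub>0(M)\<close> and the fibre over every \<open>h > 0\<close> be \<open>C\<^sub>0(M) \<oplus> C\<^sub>0(M)\<close>; a section \<open>h \<mapsto> (f\<^sub>h, g\<^sub>h)\<close> is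
  continuous if it is continuous in norm, with \<open>g\<^sub>0 = 0\<close>.  The maps \<open>\<pi>\<^sub>h f = (f, 0)\<close> are injective,
  turn every function into a continuous section and, the fibres being commutative, satisfy the
  commutator condition for the zero bracket.  However, the image of \<open>\<pi>\<^sub>1\<close> stays in the first summand, and so
  does its restriction to any subset \<open>B\<close>: an element \<open>(0, g)\<close> keeps distance at least \<open>\<parallel>g\<parallel>\<close> from it.
  Since \<open>C\<^sub>0(M)\<close> is not zero, no restriction has dense image.

  Two facts carry the verification.  The first is that the family of fibres is a continuous field:
  all fibres are closed *-subalgebras of the one C*-algebra \<open>C\<^sub>0(M) \<oplus> C\<^sub>0(M)\<close>, and norm-continuous
  functions with values in such a family form a continuous field as soon as they pass through every
  point of every fibre (\<open>continuous_field_of_subalgebras\<close>).  Here the section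
  \<open>s \<mapsto> (f, (s / t) g)\<close> passes through \<open>(f, g)\<close> at \<open>t\<close>.

  The second is that the compactly supported smooth functions are dense in \<open>C\<^sub>0(M)\<close>
  (\<open>dense_star_subalgebra_Cinf_c\<close>).  Bump functions are built in one chart as products over the
  coordinates of the function that is \<open>exp (- 1 / t)\<close> for \<open>t > 0\<close> and 0 otherwise, composed with
  quadratic polynomials; in this form their smoothness in
  every other chart needs only sums, products and the chain rule with a function of one variable.
  A function in \<open>C\<^sub>0(M)\<close> is then approximated by a weighted average of its values at finitely many
  points, with bump functions as weights.
\<close>


section \<open>Calculus of \<open>C\<^sup>k\<close> functions on open sets of Euclidean space\<close>

lemma continuous_map_Euclidean_subtopology:
  "continuous_map (subtopology (Euclidean_space n) U) euclidean f \<longleftrightarrow>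
    continuous_on (topspace (Euclidean_space n) \<inter> U) f"
  by (simp add: Euclidean_space_def subtopology_subtopology euclidean_product_topology)

lemma openin_Euclidean_space_iff:
  "openin (Euclidean_space n) U \<longleftrightarrow> (\<exists>T. open T \<and> U = T \<inter> topspace (Euclidean_space n))"
  by (auto simp: Euclidean_space_def openin_subtopology euclidean_product_topology)

text \<open>
  A partial derivative at a point of an open set only sees nearby points of the set; this is what makes
  \<^const>\<open>Ck_on\<close> insensitive to the values of a function outside the set.
\<close>

lemma eventually_coordinate_line_in_open:
  assumes U: "openin (Euclidean_space n) U" and "x \<in> U" "i < n"
  shows "\<forall>\<^sub>F t in nhds (x i). x(i := t) \<in> U"
proof -
  obtain T where T: "open T" "U = T \<inter> topspace (Euclidean_space n)"
    using U by (auto simp: openin_Euclidean_space_iff)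
  have "continuous_on UNIV (\<lambda>t. x(i := t))"
    by (intro continuous_on_coordinatewise_then_product) (case_tac "ia = i"; simp)
  then have "((\<lambda>t. x(i := t)) \<longlongrightarrow> x(i := x i)) (nhds (x i))"
    by (metis UNIV_I continuous_on_def tendsto_at_iff_tendsto_nhds)
  moreover have "x \<in> T" using T \<open>x \<in> U\<close> by auto
  ultimately have "\<forall>\<^sub>F t in nhds (x i). x(i := t) \<in> T"
    using T(1) by (auto simp: tendsto_def)
  then show ?thesis
    by eventually_elim (use T assms(2,3) in \<open>auto simp: topspace_Euclidean_space\<close>)
qed

lemma Ck_on_continuous_on:
  "Ck_on n k U f \<Longrightarrow> continuous_on (topspace (Euclidean_space n) \<inter> U) f"
  by (cases k) (simp_all add: continuous_map_Euclidean_subtopology)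

text \<open>
  The assumption at order \<open>j\<close> supplies the continuity of \<open>f\<close>.  In inductions on the order the induction
  hypothesis provides it, so that continuity is proved only once, in the base case.
\<close>

lemma Ck_on_SucI:
  assumes "Ck_on n j U f"
    and "\<And>i. i < n \<Longrightarrow> \<exists>d. (\<forall>x\<in>U. ((\<lambda>t. f (x(i := t))) has_vector_derivative d x) (at (x i)))
      \<and> Ck_on n k U d"
  shows "Ck_on n (Suc k) U f"
  using Ck_on_continuous_on[OF assms(1)] assms(2)
  by (simp add: continuous_map_Euclidean_subtopology)

lemma Ck_on_SucE:
  assumes "Ck_on n (Suc k) U f" "i < n"
  obtains d where
    "\<And>x. x \<in> U \<Longrightarrow> ((\<lambda>t. f (x(i := t))) has_vector_derivative d x) (at (x i))"
    "Ck_on n k U d"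
  using assms unfolding Ck_on.simps by blast

lemma Ck_on_SucD: "Ck_on n (Suc k) U f \<Longrightarrow> Ck_on n k U f"
  by (induction k arbitrary: f) (simp, force)

lemma Ck_on_cong:
  assumes U: "openin (Euclidean_space n) U" and eq: "\<And>x. x \<in> U \<Longrightarrow> f x = g x"
    and f: "Ck_on n k U f"
  shows "Ck_on n k U g"
proof -
  have cont: "continuous_map (subtopology (Euclidean_space n) U) euclidean g"
    unfolding continuous_map_Euclidean_subtopology
    using Ck_on_continuous_on[OF f] by (rule continuous_on_eq) (simp add: eq)
  have "((\<lambda>t. g (x(i := t))) has_vector_derivative d) (at (x i))"
    if "x \<in> U" "i < n" "((\<lambda>t. f (x(i := t))) has_vector_derivative d) (at (x i))" for x i d
  proof -
    have ev: "\<forall>\<^sub>F t in nhds (x i). f (x(i := t)) = g (x(i := t))"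
      using eventually_coordinate_line_in_open[OF U that(1,2)] by eventually_elim (rule eq)
    show ?thesis
      using that(3) has_vector_derivative_cong_ev[where f = "\<lambda>t. f (x(i := t))" and g = "\<lambda>t. g (x(i := t))" and S = UNIV] ev
        eq[OF that(1)]
      by simp
  qed
  then show ?thesis
    using f cont by (cases k) (simp, fastforce)
qed

lemma Ck_on_const: "Ck_on n k U (\<lambda>x. c)"
proof (induction k arbitrary: c)
  case (Suc k)
  then show ?case
    by (auto simp: continuous_map_Euclidean_subtopology intro!: exI[of _ "\<lambda>x. 0"])
qed (simp add: continuous_map_Euclidean_subtopology)

lemma Ck_on_add:
  "Ck_on n k U f \<Longrightarrow> Ck_on n k U g \<Longrightarrow> Ck_on n k U (\<lambda>x. f x + g x)"
proof (induction k arbitrary: f g)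
  case (Suc k)
  show ?case
  proof (rule Ck_on_SucI)
    show "Ck_on n k U (\<lambda>x. f x + g x)"
      using Suc.prems[THEN Ck_on_SucD] by (rule Suc.IH)
    fix i assume "i < n"
    obtain f' where f': "\<And>x. x \<in> U \<Longrightarrow> ((\<lambda>t. f (x(i := t))) has_vector_derivative f' x) (at (x i))"
        "Ck_on n k U f'"
      by (rule Ck_on_SucE[OF Suc.prems(1) \<open>i < n\<close>]) blast
    obtain g' where g': "\<And>x. x \<in> U \<Longrightarrow> ((\<lambda>t. g (x(i := t))) has_vector_derivative g' x) (at (x i))"
        "Ck_on n k U g'"
      by (rule Ck_on_SucE[OF Suc.prems(2) \<open>i < n\<close>]) blast
    show "\<exists>d. (\<forall>x\<in>U. ((\<lambda>t. f (x(i := t)) + g (x(i := t))) has_vector_derivative d x) (at (x i)))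
        \<and> Ck_on n k U d"
      using Suc.IH[OF f'(2) g'(2)]
      by (intro exI[of _ "\<lambda>x. f' x + g' x"]) (auto intro: has_vector_derivative_add f'(1) g'(1))
  qed
qed (auto simp: continuous_map_Euclidean_subtopology intro!: continuous_on_add)

lemma Ck_on_mult:
  fixes f g :: "(nat \<Rightarrow> real) \<Rightarrow> 'v::real_normed_algebra"
  shows "Ck_on n k U f \<Longrightarrow> Ck_on n k U g \<Longrightarrow> Ck_on n k U (\<lambda>x. f x * g x)"
proof (induction k arbitrary: f g)
  case (Suc k)
  note fg = Suc.prems[THEN Ck_on_SucD]
  show ?case
  proof (rule Ck_on_SucI)
    show "Ck_on n k U (\<lambda>x. f x * g x)"
      using fg by (rule Suc.IH)
    fix i assume "i < n"
    obtain f' where f': "\<And>x. x \<in> U \<Longrightarrow> ((\<lambda>t. f (x(i := t))) has_vector_derivative f' x) (at (x i))"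
        "Ck_on n k U f'"
      by (rule Ck_on_SucE[OF Suc.prems(1) \<open>i < n\<close>]) blast
    obtain g' where g': "\<And>x. x \<in> U \<Longrightarrow> ((\<lambda>t. g (x(i := t))) has_vector_derivative g' x) (at (x i))"
        "Ck_on n k U g'"
      by (rule Ck_on_SucE[OF Suc.prems(2) \<open>i < n\<close>]) blast
    have "((\<lambda>t. f (x(i := t)) * g (x(i := t))) has_vector_derivative (f x * g' x + f' x * g x)) (at (x i))"
      if "x \<in> U" for x
      using has_vector_derivative_mult[OF f'(1)[OF that] g'(1)[OF that]] by simp
    moreover have "Ck_on n k U (\<lambda>x. f x * g' x + f' x * g x)"
      by (intro Ck_on_add Suc.IH fg f' g')
    ultimately show "\<exists>d. (\<forall>x\<in>U. ((\<lambda>t. f (x(i := t)) * g (x(i := t))) has_vector_derivative d x) (at (x i)))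
        \<and> Ck_on n k U d"
      by (intro exI[of _ "\<lambda>x. f x * g' x + f' x * g x"]) auto
  qed
qed (auto simp: continuous_map_Euclidean_subtopology intro!: continuous_on_mult)

lemma Ck_on_bounded_linear:
  assumes L: "bounded_linear L"
  shows "Ck_on n k U f \<Longrightarrow> Ck_on n k U (\<lambda>x. L (f x))"
proof (induction k arbitrary: f)
  case 0
  then show ?case
    by (auto simp: continuous_map_Euclidean_subtopology bounded_linear.continuous_on[OF L])
next
  case (Suc k)
  show ?case
  proof (rule Ck_on_SucI)
    show "Ck_on n k U (\<lambda>x. L (f x))"
      using Suc.prems[THEN Ck_on_SucD] by (rule Suc.IH)
    fix i assume "i < n"
    obtain f' where f': "\<And>x. x \<in> U \<Longrightarrow> ((\<lambda>t. f (x(i := t))) has_vector_derivative f' x) (at (x i))"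
        "Ck_on n k U f'"
      by (rule Ck_on_SucE[OF Suc.prems \<open>i < n\<close>]) blast
    show "\<exists>d. (\<forall>x\<in>U. ((\<lambda>t. L (f (x(i := t)))) has_vector_derivative d x) (at (x i)))
        \<and> Ck_on n k U d"
      using bounded_linear.has_vector_derivative[OF L f'(1)] Suc.IH[OF f'(2)]
      by (intro exI[of _ "\<lambda>x. L (f' x)"]) auto
  qed
qed

lemma Ck_on_inverse:
  fixes f :: "(nat \<Rightarrow> real) \<Rightarrow> real"
  assumes nz: "\<And>x. x \<in> U \<Longrightarrow> f x \<noteq> 0"
  shows "Ck_on n k U f \<Longrightarrow> Ck_on n k U (\<lambda>x. inverse (f x))"
proof (induction k)
  case 0
  then show ?case
    by (auto simp: continuous_map_Euclidean_subtopology nz intro!: continuous_on_inverse)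
next
  case (Suc k)
  note IH = Suc.IH[OF Ck_on_SucD[OF Suc.prems]]
  show ?case
  proof (rule Ck_on_SucI[OF IH])
    fix i assume "i < n"
    obtain f' where f': "\<And>x. x \<in> U \<Longrightarrow> ((\<lambda>t. f (x(i := t))) has_vector_derivative f' x) (at (x i))"
        "Ck_on n k U f'"
      by (rule Ck_on_SucE[OF Suc.prems \<open>i < n\<close>]) blast
    let ?d = "\<lambda>x. (- 1) * (inverse (f x) * f' x * inverse (f x))"
    have "((\<lambda>t. inverse (f (x(i := t)))) has_vector_derivative ?d x) (at (x i))" if "x \<in> U" for x
      using DERIV_inverse'[of "\<lambda>t. f (x(i := t))" "f' x" "x i" UNIV] f'(1)[OF that] nz[OF that]
      by (simp add: has_real_derivative_iff_has_vector_derivative)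
    moreover have "Ck_on n k U ?d"
      by (intro Ck_on_mult Ck_on_const f' IH)
    ultimately show "\<exists>d. (\<forall>x\<in>U. ((\<lambda>t. inverse (f (x(i := t)))) has_vector_derivative d x) (at (x i)))
        \<and> Ck_on n k U d"
      by (intro exI[of _ ?d]) blast
  qed
qed

lemma Ck_on_prod:
  fixes f :: "'i \<Rightarrow> (nat \<Rightarrow> real) \<Rightarrow> 'v::{real_normed_algebra_1, comm_monoid_mult}"
  assumes "\<And>i. i \<in> I \<Longrightarrow> Ck_on n k U (f i)"
  shows "Ck_on n k U (\<lambda>x. \<Prod>i\<in>I. f i x)"
  using assms by (induction I rule: infinite_finite_induct) (auto intro: Ck_on_const Ck_on_mult)

text \<open>
  The partial derivatives on the two sets agree on the overlap because derivatives are unique, so they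
  glue to one function, to which the induction hypothesis applies.
\<close>

lemma Ck_on_Un:
  assumes U: "openin (Euclidean_space n) U" and V: "openin (Euclidean_space n) V"
  shows "Ck_on n k U f \<Longrightarrow> Ck_on n k V f \<Longrightarrow> Ck_on n k (U \<union> V) f"
proof (induction k arbitrary: f)
  case 0
  show ?case
  proof (simp add: continuous_map_Euclidean_subtopology Int_Un_distrib)
    let ?E = "topspace (Euclidean_space n)"
    have "openin (top_of_set (U \<union> V)) U" "openin (top_of_set (U \<union> V)) V"
      using U V unfolding openin_Euclidean_space_iff openin_open by blast+
    moreover have "continuous_on U f" "continuous_on V f"
      using 0 openin_subset[OF U] openin_subset[OF V]
      by (simp_all add: continuous_map_Euclidean_subtopology Int_absorb1)
    ultimately have "continuous_on (U \<union> V) f"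
      by (rule continuous_on_Un_local_open)
    then show "continuous_on (?E \<inter> U \<union> ?E \<inter> V) f"
      by (rule continuous_on_subset) blast
  qed
next
  case (Suc k)
  show ?case
  proof (rule Ck_on_SucI)
    show "Ck_on n k (U \<union> V) f"
      using Suc.prems[THEN Ck_on_SucD] by (rule Suc.IH)
    fix i assume "i < n"
    obtain d where d: "\<And>x. x \<in> U \<Longrightarrow> ((\<lambda>t. f (x(i := t))) has_vector_derivative d x) (at (x i))"
        "Ck_on n k U d"
      by (rule Ck_on_SucE[OF Suc.prems(1) \<open>i < n\<close>]) blast
    obtain e where e: "\<And>x. x \<in> V \<Longrightarrow> ((\<lambda>t. f (x(i := t))) has_vector_derivative e x) (at (x i))"
        "Ck_on n k V e"
      by (rule Ck_on_SucE[OF Suc.prems(2) \<open>i < n\<close>]) blast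
    define g where "g x = (if x \<in> U then d x else e x)" for x
    have g: "((\<lambda>t. f (x(i := t))) has_vector_derivative g x) (at (x i))" if "x \<in> U \<union> V" for x
      using d e that by (auto simp: g_def)
    have "Ck_on n k U g"
      by (rule Ck_on_cong[OF U _ d(2)]) (simp add: g_def)
    moreover have "e x = g x" if "x \<in> V" for x
      using g[of x] e(1)[OF that] that vector_derivative_unique_at by blast
    then have "Ck_on n k V g"
      using V e(2) Ck_on_cong by blast
    ultimately have "Ck_on n k (U \<union> V) g"
      by (rule Suc.IH)
    with g show "\<exists>d. (\<forall>x\<in>U \<union> V. ((\<lambda>t. f (x(i := t))) has_vector_derivative d x) (at (x i)))
        \<and> Ck_on n k (U \<union> V) d"
      by blast
  qed
qed

text \<open>
  The family is closed under differentiation up to linear combinations: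
  \<open>flat j' = flat (j + 2) - j * flat (j + 1)\<close>.  Hence smoothness of compositions with
  \<open>flat 0\<close>, which is \<open>exp (- 1 / t)\<close> for \<open>t > 0\<close>, follows by an induction over all members at once.
\<close>

definition flat :: "nat \<Rightarrow> real \<Rightarrow> real" where
  "flat j t = (if t > 0 then exp (- 1 / t) / t ^ j else 0)"

lemma flat_pos_iff: "flat j t > 0 \<longleftrightarrow> t > 0"
  by (simp add: flat_def)

lemma flat_nonneg: "flat j t \<ge> 0"
  by (simp add: flat_def)

text \<open>
  Substituting \<open>u = 1 / t\<close> turns this into the statement that \<open>exp u\<close> beats every power of \<open>u\<close>.
\<close>

lemma flat_tendsto_0: "(flat j \<longlongrightarrow> 0) (at 0)"
proof -
  have "((\<lambda>t. inverse t ^ j / exp (inverse t)) \<longlongrightarrow> (0::real)) (at_right 0)"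
    by (rule filterlim_compose[OF tendsto_power_div_exp_0 filterlim_inverse_at_top_right])
  then have "(flat j \<longlongrightarrow> 0) (at_right 0)"
    by (rule tendsto_cong[THEN iffD1, rotated])
      (auto simp: eventually_at_filter flat_def exp_minus field_simps)
  moreover have "(flat j \<longlongrightarrow> 0) (at_left 0)"
    by (rule tendsto_eventually) (auto simp: eventually_at_filter flat_def)
  ultimately show ?thesis
    by (simp add: filterlim_at_split)
qed

lemma flat_has_derivative:
  "(flat j has_real_derivative (flat (j + 2) t - real j * flat (j + 1) t)) (at t)"
proof -
  consider "t > 0" | "t < 0" | "t = 0" by linarith
  then show ?thesis
  proof cases
    case 1
    have "((\<lambda>t. exp (- 1 / t) / t ^ j) has_real_derivative
        (flat (j + 2) t - real j * flat (j + 1) t)) (at t)"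
      by (rule derivative_eq_intros refl | use 1 in force)+
        (use 1 in \<open>cases j; simp add: flat_def field_simps power2_eq_square\<close>)
    moreover have "\<forall>\<^sub>F s in nhds t. s \<in> {0<..}"
      using 1 by (intro eventually_nhds_in_open) auto
    then have "\<forall>\<^sub>F s in nhds t. flat j s = exp (- 1 / s) / s ^ j"
      by eventually_elim (simp add: flat_def)
    ultimately show ?thesis
      by (subst DERIV_cong_ev[OF refl _ refl])
  next
    case 2
    have "\<forall>\<^sub>F s in nhds t. s \<in> {..<0}"
      using 2 by (intro eventually_nhds_in_open) auto
    then have "\<forall>\<^sub>F s in nhds t. flat j s = 0"
      by eventually_elim (simp add: flat_def)
    then show ?thesis
      using 2 by (subst DERIV_cong_ev[OF refl _ refl]) (auto simp: flat_def)
  next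
    case 3
    \<comment> \<open>The difference quotient at 0 is again a member of the family.\<close>
    have "(\<lambda>s. (flat j s - flat j 0) / (s - 0)) = flat (j + 1)"
      by (auto simp: flat_def)
    then show ?thesis
      using 3 flat_tendsto_0[of "j + 1"] by (simp add: has_field_derivative_iff flat_def[of _ 0])
  qed
qed

text \<open>
  The chain rule is needed only for an outer function of one variable: the derivative of
  \<open>flat j \<circ> u\<close> is a product of the derivative of \<open>u\<close> with compositions of the same kind.
\<close>

lemma Ck_on_flat:
  fixes u :: "(nat \<Rightarrow> real) \<Rightarrow> real"
  shows "Ck_on n k U u \<Longrightarrow> Ck_on n k U (\<lambda>x. flat j (u x))"
proof (induction k arbitrary: j)
  case 0
  then show ?case
    unfolding Ck_on.simps continuous_map_Euclidean_subtopology
    by (intro continuous_on_compose2[OF DERIV_continuous_on[OF DERIV_subset[OF flat_has_derivative]], of UNIV]) auto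
next
  case (Suc k)
  note u = Ck_on_SucD[OF Suc.prems]
  show ?case
  proof (rule Ck_on_SucI[OF Suc.IH[OF u]])
    fix i assume "i < n"
    obtain u' where u': "\<And>x. x \<in> U \<Longrightarrow> ((\<lambda>t. u (x(i := t))) has_vector_derivative u' x) (at (x i))"
        "Ck_on n k U u'"
      by (rule Ck_on_SucE[OF Suc.prems \<open>i < n\<close>]) blast
    let ?d = "\<lambda>x. (flat (j + 2) (u x) + (- real j) * flat (j + 1) (u x)) * u' x"
    have "((\<lambda>t. flat j (u (x(i := t)))) has_vector_derivative ?d x) (at (x i))" if "x \<in> U" for x
      using DERIV_chain2[OF flat_has_derivative, of "\<lambda>t. u (x(i := t))" "u' x" "x i" UNIV j] u'(1)[OF that]
      by (simp add: has_real_derivative_iff_has_vector_derivative)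
    moreover have "Ck_on n k U ?d"
      by (intro Ck_on_mult Ck_on_add Ck_on_const u' Suc.IH u)
    ultimately show "\<exists>d. (\<forall>x\<in>U. ((\<lambda>t. flat j (u (x(i := t)))) has_vector_derivative d x) (at (x i)))
        \<and> Ck_on n k U d"
      by (intro exI[of _ ?d]) blast
  qed
qed


section \<open>Compactly supported smooth functions are dense\<close>

text \<open>
  Boxes rather than balls, because the bump functions below are products over the coordinates and
  have boxes as their supports.
\<close>

lemma coordinate_box_in_open:
  assumes W: "openin (Euclidean_space n) W" and "c \<in> W"
  obtains r where "r > 0" "{y \<in> topspace (Euclidean_space n). \<forall>j<n. \<bar>y j - c j\<bar> \<le> r} \<subseteq> W"
proof -
  obtain T where T: "open T" "W = T \<inter> topspace (Euclidean_space n)"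
    using W by (auto simp: openin_Euclidean_space_iff)
  then have "openin (product_topology (\<lambda>i::nat. euclideanreal) UNIV) T" "c \<in> T"
    using \<open>c \<in> W\<close> by (auto simp: euclidean_product_topology)
  then obtain B where B: "c \<in> Pi\<^sub>E UNIV B" "\<And>i. open (B i)" "Pi\<^sub>E UNIV B \<subseteq> T"
    using product_topology_open_contains_basis[of "\<lambda>i::nat. euclideanreal" UNIV T c] by auto
  have "\<exists>e>0. cball (c i) e \<subseteq> B i" for i
    using B open_contains_cball by (metis PiE_mem UNIV_I)
  then obtain e where e: "\<And>i. e i > 0" "\<And>i. cball (c i) (e i) \<subseteq> B i"
    by metis
  define r where "r = Min (insert 1 (e ` {..<n}))"
  have r: "r > 0" "\<And>j. j < n \<Longrightarrow> r \<le> e j"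
    by (auto simp: r_def e)
  have "y \<in> W" if y: "y \<in> topspace (Euclidean_space n)" "\<forall>j<n. \<bar>y j - c j\<bar> \<le> r" for y
  proof -
    have "y j \<in> B j" for j
    proof (cases "j < n")
      case True
      then have "\<bar>y j - c j\<bar> \<le> e j" using y(2) r(2) by force
      then show ?thesis using e(2)[of j] by (auto simp: dist_real_def)
    next
      case False
      then have "y j = c j" using y(1) \<open>c \<in> W\<close> T by (simp add: topspace_Euclidean_space)
      then show ?thesis using B(1) by auto
    qed
    then show ?thesis using B(3) T y(1) by auto
  qed
  with r(1) show ?thesis by (intro that) auto
qed

lemma compactin_coordinate_box:
  assumes c: "c \<in> topspace (Euclidean_space n)"
  shows "compactin (Euclidean_space n) {y \<in> topspace (Euclidean_space n). \<forall>j<n. \<bar>y j - c j\<bar> \<le> r}"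
proof -
  have "{y \<in> topspace (Euclidean_space n). \<forall>j<n. \<bar>y j - c j\<bar> \<le> r} =
      Pi\<^sub>E UNIV (\<lambda>j. if j < n then cball (c j) r else {0})" (is "?B = _")
    by (auto simp: topspace_Euclidean_space PiE_UNIV_domain dist_real_def abs_minus_commute
        split: if_splits)
  then have "compactin (powertop_real UNIV) ?B"
    by (simp add: compactin_PiE)
  then show ?thesis
    by (auto simp: Euclidean_space_def compactin_subtopology)
qed

context smooth_manifold
begin

text \<open>
  Smoothness in all charts, for functions with values in any normed space: bump functions are
  real-valued, while \<^const>\<open>Cinf\<close> consists of complex-valued functions.
\<close>

definition smooth :: "('m \<Rightarrow> 'v::real_normed_vector) \<Rightarrow> bool" where
  "smooth f \<longleftrightarrow> (\<forall>k. \<forall>(U, \<phi>)\<in>At. Ck_on n k (\<phi> ` U) (\<lambda>x. f (inv_into U \<phi> x)))"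

lemma smoothI:
  "(\<And>k U \<phi>. (U, \<phi>) \<in> At \<Longrightarrow> Ck_on n k (\<phi> ` U) (\<lambda>x. f (inv_into U \<phi> x))) \<Longrightarrow> smooth f"
  by (auto simp: smooth_def)

lemma smoothD: "smooth f \<Longrightarrow> (U, \<phi>) \<in> At \<Longrightarrow> Ck_on n k (\<phi> ` U) (\<lambda>x. f (inv_into U \<phi> x))"
  by (auto simp: smooth_def)

lemma smooth_const: "smooth (\<lambda>p. c)"
  by (rule smoothI) (rule Ck_on_const)

lemma smooth_add: "smooth f \<Longrightarrow> smooth g \<Longrightarrow> smooth (\<lambda>p. f p + g p)"
  by (rule smoothI) (rule Ck_on_add; rule smoothD)

lemma smooth_mult:
  fixes f g :: "'m \<Rightarrow> 'v::real_normed_algebra"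
  shows "smooth f \<Longrightarrow> smooth g \<Longrightarrow> smooth (\<lambda>p. f p * g p)"
  by (rule smoothI) (rule Ck_on_mult; rule smoothD)

lemma smooth_bounded_linear: "bounded_linear L \<Longrightarrow> smooth f \<Longrightarrow> smooth (\<lambda>p. L (f p))"
  by (rule smoothI) (erule Ck_on_bounded_linear, rule smoothD)

lemma smooth_sum: "(\<And>i. i \<in> I \<Longrightarrow> smooth (f i)) \<Longrightarrow> smooth (\<lambda>p. \<Sum>i\<in>I. f i p)"
  by (induction I rule: infinite_finite_induct) (auto intro: smooth_const smooth_add)

lemma smooth_inverse:
  fixes f :: "'m \<Rightarrow> real"
  assumes "\<And>p. f p \<noteq> 0" "smooth f"
  shows "smooth (\<lambda>p. inverse (f p))"
  by (rule smoothI, rule Ck_on_inverse) (use assms in \<open>auto intro: smoothD\<close>)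

lemma chart_inj: "(U, \<phi>) \<in> At \<Longrightarrow> inj_on \<phi> U"
  using chart_homeo[of U \<phi>] openin_subset[OF chart_domain[of U \<phi>]]
  by (auto simp: homeomorphic_eq_everything_map Int_absorb1)

lemma chart_continuous:
  "(U, \<phi>) \<in> At \<Longrightarrow> continuous_map (subtopology X U) (subtopology (Euclidean_space n) (\<phi> ` U)) \<phi>"
  using chart_homeo by (auto simp: homeomorphic_eq_everything_map)

lemma chart_inv_continuous:
  assumes "(U, \<phi>) \<in> At"
  shows "continuous_map (subtopology (Euclidean_space n) (\<phi> ` U)) X (inv_into U \<phi>)"
proof -
  have "topspace (subtopology X U) = U"
    using openin_subset[OF chart_domain[OF assms]] by (simp add: Int_absorb1)
  moreover obtain g where g: "homeomorphic_maps (subtopology X U) (subtopology (Euclidean_space n) (\<phi> ` U)) \<phi> g"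
    using chart_homeo[OF assms] homeomorphic_map_maps by blast
  ultimately have "g y = inv_into U \<phi> y" if "y \<in> \<phi> ` U" for y
    using that chart_inj[OF assms] by (auto simp: homeomorphic_maps_def inv_into_f_f)
  with g have "continuous_map (subtopology (Euclidean_space n) (\<phi> ` U)) (subtopology X U) (inv_into U \<phi>)"
    unfolding homeomorphic_maps_def by (auto elim!: continuous_map_eq)
  then show ?thesis
    by (simp add: continuous_map_in_subtopology)
qed

lemma chart_image_open:
  assumes "(U, \<phi>) \<in> At" "openin X W" "W \<subseteq> U"
  shows "openin (Euclidean_space n) (\<phi> ` W)"
proof -
  have "openin (subtopology X U) W"
    using assms chart_domain by (simp add: openin_open_subtopology)
  then have "openin (subtopology (Euclidean_space n) (\<phi> ` U)) (\<phi> ` W)"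
    using homeomorphic_imp_open_map[OF chart_homeo[OF assms(1)]] by (auto simp: open_map_def)
  then show ?thesis
    using openin_open_subtopology[OF chart_image[OF assms(1)]] by auto
qed

lemma smooth_continuous_map:
  assumes "smooth f"
  shows "continuous_map X euclidean f"
proof (rule pasting_lemma[where I = At and T = fst and f = "\<lambda>_. f"])
  fix c assume "c \<in> At"
  then obtain U \<phi> where c: "c = (U, \<phi>)" "(U, \<phi>) \<in> At" by (cases c) auto
  show "openin X (fst c)" using c chart_domain by auto
  have "continuous_map (subtopology (Euclidean_space n) (\<phi> ` U)) euclidean (\<lambda>x. f (inv_into U \<phi> x))"
    using smoothD[OF assms c(2), of 0] by simp
  from continuous_map_compose[OF chart_continuous[OF c(2)] this]
  have "continuous_map (subtopology X U) euclidean f"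
    by (rule continuous_map_eq) (use chart_inj[OF c(2)] in \<open>auto simp: inv_into_f_f\<close>)
  then show "continuous_map (subtopology X (fst c)) euclidean f" by (simp add: c)
next
  show "\<exists>c. c \<in> At \<and> x \<in> fst c \<and> f x = f x" if "x \<in> topspace X" for x
    using that charts_cover by fastforce
qed auto

text \<open>
  A compact set outside which the function vanishes can be handled more easily than the closure of the
  set where it does not vanish; in a Hausdorff space compact sets are closed, so the two notions agree.
\<close>

lemma Cinf_c_iff:
  "f \<in> Cinf_c n X At \<longleftrightarrow> smooth f \<and> (\<exists>K. compactin X K \<and> (\<forall>x. x \<notin> K \<longrightarrow> f x = 0))"
  (is "_ \<longleftrightarrow> ?rhs")
proof
  assume f: "f \<in> Cinf_c n X At"
  let ?K = "X closure_of {x \<in> topspace X. f x \<noteq> 0}"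
  have "f x = 0" if "x \<notin> ?K" for x
    using f that closure_of_subset[of "{x \<in> topspace X. f x \<noteq> 0}" X]
    by (auto simp: Cinf_c_def Cinf_def)
  moreover have "smooth f"
    using f by (auto simp: Cinf_c_def Cinf_def smooth_def Cinf_on_def)
  ultimately show ?rhs
    using f by (auto simp: Cinf_c_def)
next
  assume ?rhs
  then obtain K where f: "smooth f" and K: "compactin X K" "\<And>x. x \<notin> K \<Longrightarrow> f x = 0"
    by blast
  have "X closure_of {x \<in> topspace X. f x \<noteq> 0} \<subseteq> K"
    using K by (intro closure_of_minimal compactin_imp_closedin[OF Hausdorff]) auto
  then have "compactin X (X closure_of {x \<in> topspace X. f x \<noteq> 0})"
    by (intro closed_compactin[OF K(1)]) auto
  then show "f \<in> Cinf_c n X At"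
    using f K(2) compactin_subset_topspace[OF K(1)]
    by (auto simp: Cinf_c_def Cinf_def smooth_def Cinf_on_def)
qed

text \<open>
  In a chart around \<open>p\<close> choose a closed box of radius \<open>r\<close> inside the image of \<open>W\<close> and multiply, over the
  coordinates, the values of \<open>flat 0\<close> at \<open>t = r\<^sup>2 - (y\<^sub>j - c\<^sub>j)\<^sup>2\<close>.  Off the box
  some \<open>t\<close> is negative, so the product vanishes.  In another chart, smoothness is clear on the overlap with the first chart, by the compatibility of the charts, and on the
  complement of the compact support; these two open sets cover.
\<close>

lemma exists_smooth_bump:
  assumes W: "openin X W" and "p \<in> W"
  obtains b :: "'m \<Rightarrow> real" and K where "smooth b" "\<And>x. b x \<ge> 0" "b p > 0"
    "compactin X K" "K \<subseteq> W" "\<And>x. x \<notin> K \<Longrightarrow> b x = 0"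
proof -
  obtain V \<psi> where V: "(V, \<psi>) \<in> At" "p \<in> V"
    using charts_cover openin_subset[OF W] \<open>p \<in> W\<close> by blast
  note inj = chart_inj[OF V(1)]
  have "openin X (W \<inter> V)"
    using W chart_domain[OF V(1)] by blast
  then have open_image: "openin (Euclidean_space n) (\<psi> ` (W \<inter> V))"
    by (rule chart_image_open[OF V(1)]) auto
  let ?c = "\<psi> p"
  have "?c \<in> \<psi> ` (W \<inter> V)" using \<open>p \<in> W\<close> V(2) by auto
  then obtain r where r: "r > 0" and box:
    "{y \<in> topspace (Euclidean_space n). \<forall>j<n. \<bar>y j - ?c j\<bar> \<le> r} \<subseteq> \<psi> ` (W \<inter> V)" (is "?B \<subseteq> _")
    by (rule coordinate_box_in_open[OF open_image])
  define K where "K = inv_into V \<psi> ` ?B"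
  have "compactin (Euclidean_space n) ?B"
    using openin_subset[OF open_image] \<open>?c \<in> _\<close> by (intro compactin_coordinate_box) auto
  then have "compactin (subtopology (Euclidean_space n) (\<psi> ` V)) ?B"
    using box by (auto simp: compactin_subtopology)
  then have K: "compactin X K"
    unfolding K_def using image_compactin chart_inv_continuous[OF V(1)] by blast
  have "K \<subseteq> W"
    using box inj by (auto simp: K_def inv_into_f_f dest!: subsetD)
  \<comment> \<open>The subtractions are spelled as sums and products to match the closure rules for smooth functions.\<close>
  define b where
    "b x = (if x \<in> V then \<Prod>j<n. flat 0 (r\<^sup>2 + (- 1) * ((\<psi> x j + - ?c j) * (\<psi> x j + - ?c j))) else 0)" for x
  have b_eq_0: "b x = 0" if "x \<notin> K" for x
  proof (cases "x \<in> V")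
    case True
    then have "\<psi> x \<in> topspace (Euclidean_space n)"
      using openin_subset[OF chart_image[OF V(1)]] by auto
    moreover have "\<psi> x \<notin> ?B"
    proof
      assume "\<psi> x \<in> ?B"
      then have "inv_into V \<psi> (\<psi> x) \<in> K" unfolding K_def by (rule imageI)
      then show False using that inv_into_f_f[OF inj True] by simp
    qed
    ultimately obtain j where j: "j < n" "\<bar>\<psi> x j - ?c j\<bar> > r" by (auto simp: not_le)
    then have "r\<^sup>2 < \<bar>\<psi> x j - ?c j\<bar>\<^sup>2" using r power_strict_mono[of r "\<bar>\<psi> x j - ?c j\<bar>" 2] by (simp del: power2_abs)
    then have "flat 0 (r\<^sup>2 + (- 1) * ((\<psi> x j + - ?c j) * (\<psi> x j + - ?c j))) = 0"
      by (simp add: flat_def power2_eq_square)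
    then show ?thesis using j(1) by (auto simp: b_def intro!: prod_zero)
  qed (simp add: b_def)
  have "Ck_on n k (\<phi> ` U) (\<lambda>x. b (inv_into U \<phi> x))" if U: "(U, \<phi>) \<in> At" for U \<phi> k
  proof -
    note injU = chart_inj[OF U]
    have o1: "openin (Euclidean_space n) (\<phi> ` (U \<inter> V))"
      using chart_domain[OF U] chart_domain[OF V(1)] by (intro chart_image_open[OF U]) auto
    have o2: "openin (Euclidean_space n) (\<phi> ` (U - K))"
      using chart_domain[OF U] compactin_imp_closedin[OF Hausdorff K]
      by (intro chart_image_open[OF U] openin_diff) auto
    have "Ck_on n k (\<phi> ` (U \<inter> V)) (\<lambda>x. \<psi> (inv_into U \<phi> x) j)" if "j < n" for j
      using charts_compatible[OF U V(1) that] by (simp add: Cinf_on_def)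
    then have "Ck_on n k (\<phi> ` (U \<inter> V)) (\<lambda>x. \<Prod>j<n. flat 0 (r\<^sup>2 +
        (- 1) * ((\<psi> (inv_into U \<phi> x) j + - ?c j) * (\<psi> (inv_into U \<phi> x) j + - ?c j))))"
      by (intro Ck_on_prod Ck_on_flat Ck_on_add Ck_on_mult Ck_on_const) auto
    then have "Ck_on n k (\<phi> ` (U \<inter> V)) (\<lambda>x. b (inv_into U \<phi> x))"
      by (rule Ck_on_cong[OF o1, rotated]) (use injU in \<open>auto simp: b_def inv_into_f_f\<close>)
    moreover have "Ck_on n k (\<phi> ` (U - K)) (\<lambda>x. b (inv_into U \<phi> x))"
      by (rule Ck_on_cong[OF o2 _ Ck_on_const[of n k _ 0]])
        (use injU in \<open>auto simp: b_eq_0 inv_into_f_f\<close>)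
    ultimately have "Ck_on n k (\<phi> ` (U \<inter> V) \<union> \<phi> ` (U - K)) (\<lambda>x. b (inv_into U \<phi> x))"
      by (rule Ck_on_Un[OF o1 o2])
    moreover have "K \<subseteq> V"
      using box by (auto simp: K_def intro!: inv_into_into)
    then have "\<phi> ` (U \<inter> V) \<union> \<phi> ` (U - K) = \<phi> ` U" by auto
    ultimately show ?thesis by simp
  qed
  then have "smooth b" by (auto simp: smooth_def)
  moreover have "b p > 0" "\<And>x. b x \<ge> 0"
    using V(2) r by (auto simp: b_def flat_pos_iff flat_nonneg intro!: prod_pos prod_nonneg)
  ultimately show ?thesis
    using that K \<open>K \<subseteq> W\<close> b_eq_0 by blast
qed

lemma Cinf_c_subset_C0: "Cinf_c n X At \<subseteq> car (C0 X)"
proof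
  fix f assume "f \<in> Cinf_c n X At"
  then obtain K where "smooth f" "compactin X K" "\<And>x. x \<notin> K \<Longrightarrow> f x = 0"
    by (auto simp: Cinf_c_iff)
  then show "f \<in> car (C0 X)"
    using smooth_continuous_map compactin_subset_topspace[of X K]
    by (auto simp: C0_def intro!: exI[of _ K])
qed

lemma star_subalgebra_Cinf_c: "star_subalgebra (C0 X) (Cinf_c n X At)"
proof -
  have supp2: "\<exists>K. compactin X K \<and> (\<forall>x. x \<notin> K \<longrightarrow> h (f x) (g x) = 0)"
    if f: "f \<in> Cinf_c n X At" and g: "g \<in> Cinf_c n X At" and "h 0 0 = 0" for f g and h :: "complex \<Rightarrow> complex \<Rightarrow> complex"
  proof -
    obtain K where K: "compactin X K" "\<forall>x. x \<notin> K \<longrightarrow> f x = 0"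
      using f unfolding Cinf_c_iff by blast
    obtain L where L: "compactin X L" "\<forall>x. x \<notin> L \<longrightarrow> g x = 0"
      using g unfolding Cinf_c_iff by blast
    have "h (f x) (g x) = 0" if "x \<notin> K \<union> L" for x
      using that K(2) L(2) \<open>h 0 0 = 0\<close> by simp
    with compactin_Un[OF K(1) L(1)] show ?thesis by blast
  qed
  have zero: "(\<lambda>x. 0) \<in> Cinf_c n X At"
    by (auto simp: Cinf_c_iff smooth_const intro: exI[of _ "{}"])
  have "(\<lambda>x. f x + g x) \<in> Cinf_c n X At" "(\<lambda>x. f x * g x) \<in> Cinf_c n X At"
    if "f \<in> Cinf_c n X At" "g \<in> Cinf_c n X At" for f g
    using supp2[OF that, of "(+)"] supp2[OF that, of "(*)"] that
    by (auto simp: Cinf_c_iff smooth_add smooth_mult)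
  moreover have "(\<lambda>x. c * f x) \<in> Cinf_c n X At" "(\<lambda>x. cnj (f x)) \<in> Cinf_c n X At"
    if "f \<in> Cinf_c n X At" for f c
    using that by (auto simp: Cinf_c_iff smooth_mult smooth_const smooth_bounded_linear[OF bounded_linear_cnj])
  ultimately show ?thesis
    using zero Cinf_c_subset_C0 by (simp add: star_subalgebra_def) (simp add: C0_def)
qed

text \<open>
  Cover the compact set \<open>K\<close> off which \<open>\<bar>f\<bar> < \<epsilon>\<close> by the sets where bump functions \<open>b\<^sub>p\<close> are positive, for
  finitely many \<open>p\<close>, such that \<open>f\<close> varies by less than \<open>\<epsilon>\<close> on the support of each.  Let \<open>S\<close> be the sum of
  the \<open>b\<^sub>p\<close>.  The quotients \<open>b\<^sub>p / S\<close> would form a partition of unity on \<open>K\<close> but are not defined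
  everywhere; with a constant \<open>\<delta> > 0\<close> the weights \<open>b\<^sub>p / (S + \<delta>)\<close> are smooth on the whole manifold.
  The average of the \<open>f p\<close> with these weights differs from \<open>f * S / (S + \<delta>)\<close> by at most \<open>\<epsilon>\<close>.
  The remaining error \<open>\<bar>f\<bar> * \<delta> / (S + \<delta>)\<close> is at most \<open>\<bar>f\<bar> < \<epsilon>\<close> off \<open>K\<close>, and small on \<open>K\<close>, where \<open>S\<close> is bounded
  below, if \<open>\<delta>\<close> is small.
\<close>

lemma smooth_approximation:
  assumes f: "f \<in> car (C0 X)" and \<epsilon>: "\<epsilon> > 0"
  obtains g where "g \<in> Cinf_c n X At" "\<And>x. x \<in> topspace X \<Longrightarrow> cmod (f x - g x) \<le> 2 * \<epsilon>"
proof -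
  have cont: "continuous_map X euclidean f"
    using f by (simp add: C0_def)
  obtain K where K: "compactin X K" "\<And>x. x \<in> topspace X - K \<Longrightarrow> cmod (f x) < \<epsilon>"
    using f \<epsilon> by (fastforce simp: C0_def)
  define W where "W p = {x \<in> topspace X. f x \<in> ball (f p) \<epsilon>}" for p
  have W: "openin X (W p)" for p
    unfolding W_def using cont by (rule openin_continuous_map_preimage) auto
  define bump where "bump p b L \<longleftrightarrow> smooth b \<and> (\<forall>x. b x \<ge> 0) \<and> b p > 0 \<and> compactin X L \<and> L \<subseteq> W p \<and>
      (\<forall>x. x \<notin> L \<longrightarrow> b x = 0)" for p and b :: "'m \<Rightarrow> real" and L
  have "\<exists>b L. bump p b L" if "p \<in> K" for p
  proof -
    have "p \<in> W p"
      using that compactin_subset_topspace[OF K(1)] \<epsilon> by (auto simp: W_def)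
    from exists_smooth_bump[OF W this] show ?thesis unfolding bump_def by metis
  qed
  then obtain b L where "\<And>p. p \<in> K \<Longrightarrow> bump p (b p) (L p)"
    by metis
  then have b: "\<And>p. p \<in> K \<Longrightarrow> smooth (b p)" "\<And>p x. p \<in> K \<Longrightarrow> b p x \<ge> 0" "\<And>p. p \<in> K \<Longrightarrow> b p p > 0"
    and L: "\<And>p. p \<in> K \<Longrightarrow> compactin X (L p)" "\<And>p. p \<in> K \<Longrightarrow> L p \<subseteq> W p" "\<And>p x. p \<in> K \<Longrightarrow> x \<notin> L p \<Longrightarrow> b p x = 0"
    unfolding bump_def by auto
  let ?P = "\<lambda>p. {x \<in> topspace X. b p x \<in> {0<..}}"
  have "\<And>N. N \<in> ?P ` K \<Longrightarrow> openin X N"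
    using openin_continuous_map_preimage[OF smooth_continuous_map[OF b(1)], of _ "{0<..}"] by auto
  moreover have "K \<subseteq> \<Union>(?P ` K)"
    using b(3) compactin_subset_topspace[OF K(1)] by auto
  ultimately obtain \<N> where \<N>: "finite \<N>" "\<N> \<subseteq> ?P ` K" "K \<subseteq> \<Union>\<N>"
    using compactinD[OF K(1), of "?P ` K"] by blast
  obtain F where F: "finite F" "F \<subseteq> K" "\<N> = ?P ` F"
    using finite_subset_image[OF \<N>(1,2)] by blast
  with \<N>(3) have cover: "K \<subseteq> (\<Union>p\<in>F. ?P p)" by simp
  define S where "S x = (\<Sum>p\<in>F. b p x)" for x
  have S0: "S x \<ge> 0" for x
    unfolding S_def using b(2) F(2) by (auto intro: sum_nonneg)
  have smS: "smooth S"
    unfolding S_def using b(1) F(2) by (intro smooth_sum) auto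
  obtain m where m: "m > 0" "\<And>x. x \<in> K \<Longrightarrow> m \<le> S x"
  proof (cases "K = {}")
    case False
    have "compact (S ` K)"
      using image_compactin[OF K(1) smooth_continuous_map[OF smS]] by simp
    then obtain x where x: "x \<in> K" "\<And>y. y \<in> K \<Longrightarrow> S x \<le> S y"
      using compact_attains_inf[of "S ` K"] False by blast
    obtain p where "p \<in> F" "b p x > 0" using cover x(1) by auto
    then have "S x > 0"
      unfolding S_def using F b(2) by (intro sum_pos2[of F p]) auto
    then show ?thesis using x(2) that by blast
  qed (use that[of 1] in auto)
  have "compact (f ` K)"
    using image_compactin[OF K(1) cont] by simp
  then obtain C where C: "C > 0" "\<And>x. x \<in> K \<Longrightarrow> cmod (f x) \<le> C"
    using compact_imp_bounded by (metis bounded_pos imageI)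
  \<comment> \<open>This makes the bound \<open>C * \<delta> / m\<close> for the second error term on \<open>K\<close> equal to \<open>\<epsilon>\<close>.\<close>
  define \<delta> where "\<delta> = \<epsilon> * m / C"
  have \<delta>: "\<delta> > 0" using \<epsilon> m(1) C(1) by (simp add: \<delta>_def)
  define w where "w p x = b p x * inverse (S x + \<delta>)" for p x
  define g where "g x = (\<Sum>p\<in>F. f p * complex_of_real (w p x))" for x
  have pos: "S x + \<delta> > 0" for x using S0[of x] \<delta> by simp
  have sm: "smooth g"
    unfolding g_def w_def
    using b(1) F(2) pos
    by (intro smooth_sum smooth_mult smooth_const smooth_bounded_linear[OF bounded_linear_of_real]
        smooth_inverse smooth_add smS) (auto simp: less_imp_neq[THEN not_sym])
  have "compactin X (\<Union>p\<in>F. L p)"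
    using F(1,2) L(1) by (intro compactin_Union) auto
  moreover have "g x = 0" if "x \<notin> (\<Union>p\<in>F. L p)" for x
    unfolding g_def w_def using that L(3) F(2) by (intro sum.neutral) auto
  ultimately have gc: "g \<in> Cinf_c n X At"
    using sm by (auto simp: Cinf_c_iff)
  have "cmod (f x - g x) \<le> 2 * \<epsilon>" if x: "x \<in> topspace X" for x
  proof -
    have w0: "w p x \<ge> 0" if "p \<in> F" for p
      unfolding w_def using pos[of x] b(2) F(2) that by (auto intro!: mult_nonneg_nonneg)
    have "(\<Sum>p\<in>F. w p x) = S x * inverse (S x + \<delta>)"
      by (simp only: w_def S_def sum_distrib_right)
    then have sumw: "(\<Sum>p\<in>F. w p x) = 1 - \<delta> / (S x + \<delta>)"
      using pos[of x] by (simp add: field_simps)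
    have "f x - g x = (\<Sum>p\<in>F. (f x - f p) * complex_of_real (w p x)) + f x * complex_of_real (1 - (\<Sum>p\<in>F. w p x))"
      by (simp add: g_def left_diff_distrib right_diff_distrib sum_subtractf sum_distrib_left)
    also have "cmod \<dots> \<le> (\<Sum>p\<in>F. cmod (f x - f p) * w p x) + cmod (f x) * (\<delta> / (S x + \<delta>))"
      unfolding sumw
      by (intro norm_triangle_mono order_trans[OF norm_sum] sum_mono)
        (use w0 pos[of x] \<delta> in \<open>auto simp: norm_mult norm_divide abs_of_nonneg simp del: of_real_add of_real_divide\<close>)
    also have "(\<Sum>p\<in>F. cmod (f x - f p) * w p x) \<le> (\<Sum>p\<in>F. \<epsilon> * w p x)"
    proof (rule sum_mono)
      fix p assume p: "p \<in> F"
      show "cmod (f x - f p) * w p x \<le> \<epsilon> * w p x"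
      proof (cases "x \<in> L p")
        case True
        then have "cmod (f x - f p) \<le> \<epsilon>"
          using L(2) F(2) p by (fastforce simp: W_def dist_norm norm_minus_commute)
        then show ?thesis using w0[OF p] by (rule mult_right_mono)
      next
        case False
        then show ?thesis using L(3) F(2) p by (auto simp: w_def)
      qed
    qed
    also have "(\<Sum>p\<in>F. \<epsilon> * w p x) \<le> \<epsilon>"
      using pos[of x] \<delta> \<epsilon> by (simp add: sum_distrib_left[symmetric] sumw)
    also have "cmod (f x) * (\<delta> / (S x + \<delta>)) \<le> \<epsilon>"
    proof (cases "x \<in> K")
      case True
      have "cmod (f x) * (\<delta> / (S x + \<delta>)) \<le> C * (\<delta> / m)"
        using C True m(1) m(2)[OF True] \<delta> by (intro mult_mono divide_left_mono) auto
      also have "\<dots> = \<epsilon>" using m(1) C(1) by (simp add: \<delta>_def)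
      finally show ?thesis .
    next
      case False
      have "cmod (f x) * (\<delta> / (S x + \<delta>)) \<le> \<epsilon> * 1"
        using K(2)[of x] x False \<delta> \<epsilon> S0[of x] pos[of x] by (intro mult_mono) auto
      then show ?thesis by simp
    qed
    finally show ?thesis by simp
  qed
  with gc show ?thesis by (rule that)
qed

lemma dense_star_subalgebra_Cinf_c: "dense_star_subalgebra (C0 X) (Cinf_c n X At)"
  unfolding dense_star_subalgebra_def dense_in_def
proof (intro conjI star_subalgebra_Cinf_c Cinf_c_subset_C0 ballI allI impI)
  fix f and \<epsilon> :: real assume f: "f \<in> car (C0 X)" and "\<epsilon> > 0"
  then obtain g where g: "g \<in> Cinf_c n X At" "\<And>x. x \<in> topspace X \<Longrightarrow> cmod (f x - g x) \<le> 2 * (\<epsilon> / 3)"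
    using smooth_approximation[OF f, of "\<epsilon> / 3"] by auto
  have "(SUP x\<in>topspace X. cmod (f x - g x)) \<le> 2 * (\<epsilon> / 3)"
    using nonempty g(2) by (intro cSUP_least) auto
  then have "nrm (C0 X) (f \<ominus>\<^bsub>C0 X\<^esub> g) < \<epsilon>"
    using \<open>\<epsilon> > 0\<close> by (simp add: sub_def C0_def)
  with g(1) show "\<exists>g\<in>Cinf_c n X At. nrm (C0 X) (f \<ominus>\<^bsub>C0 X\<^esub> g) < \<epsilon>" by blast
qed

lemma poisson_manifold_zero: "poisson_manifold n X At (\<lambda>f g x. 0)"
proof
  have "(\<lambda>x. 0) \<in> Cinf_c n X At"
    using star_subalgebra_Cinf_c by (simp add: star_subalgebra_def C0_def)
  then show "(\<lambda>x. 0) \<in> Cinf n X At" by (simp add: Cinf_c_def)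
qed auto

end


section \<open>C*-algebras, direct sums and closed subalgebras\<close>

lemma (in Metric_space) mcomplete_iff:
  "mcomplete \<longleftrightarrow> (\<forall>\<sigma>. MCauchy \<sigma> \<longrightarrow> (\<exists>l\<in>M. (\<lambda>k. d (\<sigma> k) l) \<longlonglongrightarrow> 0))"
proof -
  have "(\<exists>l. limitin mtopology \<sigma> l sequentially) \<longleftrightarrow> (\<exists>l\<in>M. (\<lambda>k. d (\<sigma> k) l) \<longlonglongrightarrow> 0)"
    if "MCauchy \<sigma>" for \<sigma>
    using that by (auto simp: limitin_metric_dist_null MCauchy_def range_subsetD)
  then show ?thesis unfolding mcomplete_def by blast
qed

context cstar_algebra
begin

lemmas closed = zer_closed add_closed scl_closed mul_closed adj_closed

lemma sub_closed: "x \<in> car A \<Longrightarrow> y \<in> car A \<Longrightarrow> x \<ominus> y \<in> car A"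
  by (simp add: sub_def closed)

lemma add_zer: "x \<in> car A \<Longrightarrow> x \<oplus> \<zero> = x"
  by (metis add_comm zer_add zer_closed)

lemma add_left_comm: "x \<in> car A \<Longrightarrow> y \<in> car A \<Longrightarrow> z \<in> car A \<Longrightarrow> x \<oplus> (y \<oplus> z) = y \<oplus> (x \<oplus> z)"
  by (metis add_assoc add_comm)

lemmas add_ac = add_assoc add_comm add_left_comm

lemma scl_diff: "x \<in> car A \<Longrightarrow> (c - d) \<odot> x = c \<odot> x \<ominus> d \<odot> x"
  using scl_add_left[of x c "- d"] scl_scl[of x "- 1" d] by (simp add: sub_def)

lemma zero_scl: "x \<in> car A \<Longrightarrow> 0 \<odot> x = \<zero>"
  using scl_diff[of x 1 1] sub_self[of x] by (simp add: scl_one)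

lemma nrm_zer: "nrm A \<zero> = 0"
  using nrm_eq_0 zer_closed by blast

text \<open>
  This identity and the next ones express differences of sums, products and adjoints by differences of
  the arguments, which gives the norm estimates behind the continuity of the operations.
\<close>

lemma add_sub_add:
  assumes "a \<in> car A" "b \<in> car A" "c \<in> car A" "d \<in> car A"
  shows "(a \<oplus> b) \<ominus> (c \<oplus> d) = (a \<ominus> c) \<oplus> (b \<ominus> d)"
  using assms by (simp add: sub_def closed scl_add_right add_ac)

lemma sub_split:
  assumes "x \<in> car A" "y \<in> car A" "z \<in> car A"
  shows "x \<ominus> z = (x \<ominus> y) \<oplus> (y \<ominus> z)"
proof -
  have "x \<oplus> y \<ominus> (y \<oplus> z) = (x \<ominus> y) \<oplus> (y \<ominus> z)"
    using assms by (simp add: add_sub_add)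
  moreover have "x \<oplus> y \<ominus> (y \<oplus> z) = (x \<oplus> y) \<ominus> (z \<oplus> y)"
    using assms by (simp add: add_comm)
  moreover have "\<dots> = x \<ominus> z"
    using assms by (simp add: add_sub_add sub_self add_zer sub_closed)
  ultimately show ?thesis by simp
qed

lemma scl_sub: "x \<in> car A \<Longrightarrow> y \<in> car A \<Longrightarrow> c \<odot> (x \<ominus> y) = c \<odot> x \<ominus> c \<odot> y"
  by (simp add: sub_def scl_add_right closed scl_scl[symmetric] mult.commute)

lemma adj_sub: "x \<in> car A \<Longrightarrow> y \<in> car A \<Longrightarrow> adj A (x \<ominus> y) = adj A x \<ominus> adj A y"
  by (simp add: sub_def adj_add adj_scl closed)

lemma mul_sub_mul:
  assumes "a \<in> car A" "b \<in> car A" "c \<in> car A" "d \<in> car A"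
  shows "a \<otimes> b \<ominus> c \<otimes> d = (a \<ominus> c) \<otimes> b \<oplus> c \<otimes> (b \<ominus> d)"
proof -
  have "(a \<ominus> c) \<otimes> b = a \<otimes> b \<ominus> c \<otimes> b" "c \<otimes> (b \<ominus> d) = c \<otimes> b \<ominus> c \<otimes> d"
    using assms by (simp_all add: sub_def closed mul_add_left mul_add_right mul_scl_left mul_scl_right)
  then show ?thesis
    using assms sub_split[of "a \<otimes> b" "c \<otimes> b" "c \<otimes> d"] by (simp add: closed)
qed

lemma nrm_sub_commute:
  assumes "x \<in> car A" "y \<in> car A"
  shows "nrm A (x \<ominus> y) = nrm A (y \<ominus> x)"
proof -
  have "(- 1) \<odot> (y \<ominus> x) = x \<ominus> y"
    using assms by (simp add: sub_def scl_add_right closed scl_scl[symmetric] scl_one add_comm)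
  with nrm_scl[OF sub_closed[OF assms(2,1)], of "- 1"] show ?thesis by simp
qed

lemma nrm_sub_triangle:
  assumes "x \<in> car A" "y \<in> car A" "z \<in> car A"
  shows "nrm A (x \<ominus> z) \<le> nrm A (x \<ominus> y) + nrm A (y \<ominus> z)"
  using nrm_triangle[of "x \<ominus> y" "y \<ominus> z"] sub_split[OF assms] assms by (simp add: sub_closed)

lemma sub_zer: "x \<in> car A \<Longrightarrow> x \<ominus> \<zero> = x"
  using scl_scl[of \<zero> "- 1" 0] by (simp add: sub_def zero_scl add_zer closed)

lemma scl_zer: "c \<odot> \<zero> = \<zero>"
  using scl_scl[of \<zero> c 0] by (simp add: zero_scl closed)

lemma zer_mul_zer: "\<zero> \<otimes> \<zero> = \<zero>"
  using mul_scl_left[of \<zero> \<zero> 0] by (simp add: zero_scl closed)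

lemma adj_zer: "adj A \<zero> = \<zero>"
  using adj_scl[of \<zero> 0] by (simp add: zero_scl closed)

lemma nrm_diff_le:
  assumes "x \<in> car A" "y \<in> car A"
  shows "\<bar>nrm A x - nrm A y\<bar> \<le> nrm A (x \<ominus> y)"
  using nrm_sub_triangle[of x y \<zero>] nrm_sub_triangle[of y x \<zero>] nrm_sub_commute[OF assms] assms
  by (simp add: closed sub_zer)

text \<open>
  From \<open>\<parallel>y\<parallel>\<^sup>2 = \<parallel>y\<^sup>* y\<parallel> \<le> \<parallel>y\<^sup>*\<parallel> \<parallel>y\<parallel>\<close> one gets \<open>\<parallel>y\<parallel> \<le> \<parallel>y\<^sup>*\<parallel>\<close>; apply this to \<open>y\<close> and to its adjoint.
\<close>

lemma nrm_adj:
  assumes "x \<in> car A"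
  shows "nrm A (adj A x) = nrm A x"
proof -
  have le: "nrm A y \<le> nrm A (adj A y)" if y: "y \<in> car A" for y
  proof (cases "nrm A y = 0")
    case False
    have "nrm A y * nrm A y \<le> nrm A (adj A y) * nrm A y"
      using cstar_identity[OF y] nrm_mul[of "adj A y" y] y by (simp add: closed power2_eq_square)
    then show ?thesis using False nrm_nonneg[OF y] by simp
  qed (use nrm_nonneg adj_closed y in auto)
  from le[OF assms] le[OF adj_closed[OF assms]] show ?thesis
    using assms by (simp add: adj_adj)
qed

end

text \<open>
  \<^locale>\<open>Metric_space\<close> asks for a distance that is nonnegative and symmetric on the whole type, not only
  on the carrier, and completeness has its meaning only under this assumption.  A C*-algebra
  restricts its norm only on the carrier, so the requirement is added here.
\<close>

locale metric_cstar_algebra = cstar_algebra A + Metric_space "car A" "\<lambda>x y. nrm A (sub A x y)"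
  for A :: "'b cstar"

definition direct_sum :: "'a cstar \<Rightarrow> 'b cstar \<Rightarrow> ('a \<times> 'b) cstar" where
  "direct_sum A B = \<lparr>car = car A \<times> car B,
     zer = (zer A, zer B),
     add = (\<lambda>x y. (add A (fst x) (fst y), add B (snd x) (snd y))),
     scl = (\<lambda>c x. (scl A c (fst x), scl B c (snd x))),
     mul = (\<lambda>x y. (mul A (fst x) (fst y), mul B (snd x) (snd y))),
     adj = (\<lambda>x. (adj A (fst x), adj B (snd x))),
     nrm = (\<lambda>x. max (nrm A (fst x)) (nrm B (snd x)))\<rparr>"

lemma direct_sum_sub: "sub (direct_sum A B) x y = (sub A (fst x) (fst y), sub B (snd x) (snd y))"
  by (simp add: sub_def direct_sum_def)

lemma metric_cstar_algebra_direct_sum: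
  fixes A :: "'a cstar" and B :: "'b cstar"
  assumes "metric_cstar_algebra A" "metric_cstar_algebra B"
  shows "metric_cstar_algebra (direct_sum A B)"
proof -
  interpret A: metric_cstar_algebra A by fact
  interpret B: metric_cstar_algebra B by fact
  let ?D = "direct_sum A B"
  let ?d = "\<lambda>x y. nrm ?D (sub ?D x y)"
  have d: "?d x y = max (nrm A (sub A (fst x) (fst y))) (nrm B (sub B (snd x) (snd y)))" for x y
    by (simp add: direct_sum_sub) (simp add: direct_sum_def)
  interpret MD: Metric_space "car ?D" ?d
  proof
    fix x y z
    show "0 \<le> ?d x y" unfolding d by (simp add: le_max_iff_disj)
    show "?d x y = ?d y x" unfolding d by (simp add: A.commute B.commute)
    show "(?d x y = 0) = (x = y)" if "x \<in> car ?D" "y \<in> car ?D"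
    proof -
      have "?d x y = 0 \<longleftrightarrow> nrm A (sub A (fst x) (fst y)) = 0 \<and> nrm B (sub B (snd x) (snd y)) = 0"
        unfolding d using A.nonneg[of "fst x" "fst y"] B.nonneg[of "snd x" "snd y"] by (smt (verit))
      then show ?thesis
        using that by (auto simp: direct_sum_def prod_eq_iff)
    qed
    show "?d x z \<le> ?d x y + ?d y z" if "x \<in> car ?D" "y \<in> car ?D" "z \<in> car ?D"
      using that A.triangle[of "fst x" "fst y" "fst z"] B.triangle[of "snd x" "snd y" "snd z"]
      unfolding d by (auto simp: direct_sum_def)
  qed
  have "MD.mcomplete"
    unfolding MD.mcomplete_iff
  proof (intro allI impI)
    fix \<sigma> assume \<sigma>: "MD.MCauchy \<sigma>"
    then have "\<sigma> k \<in> car ?D" for k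
      unfolding MD.MCauchy_def by blast
    then have "fst (\<sigma> k) \<in> car A" "snd (\<sigma> k) \<in> car B" for k
      by (simp_all add: direct_sum_def mem_Times_iff)
    moreover have "\<forall>\<epsilon>>0. \<exists>N. \<forall>m k. N \<le> m \<longrightarrow> N \<le> k \<longrightarrow> ?d (\<sigma> m) (\<sigma> k) < \<epsilon>"
      using \<sigma> unfolding MD.MCauchy_def by (rule conjunct2)
    ultimately have "A.MCauchy (\<lambda>k. fst (\<sigma> k))" "B.MCauchy (\<lambda>k. snd (\<sigma> k))"
      unfolding A.MCauchy_def B.MCauchy_def d by (auto simp: image_subset_iff) meson+
    then obtain a b where a: "a \<in> car A" "(\<lambda>k. nrm A (sub A (fst (\<sigma> k)) a)) \<longlonglongrightarrow> 0"
      and b: "b \<in> car B" "(\<lambda>k. nrm B (sub B (snd (\<sigma> k)) b)) \<longlonglongrightarrow> 0"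
      using A.complete B.complete unfolding A.mcomplete_iff B.mcomplete_iff by blast
    have "(\<lambda>k. ?d (\<sigma> k) (a, b)) \<longlonglongrightarrow> 0"
      using tendsto_max[OF a(2) b(2)] by (simp add: d)
    then show "\<exists>l\<in>car ?D. (\<lambda>k. ?d (\<sigma> k) l) \<longlonglongrightarrow> 0"
      using a(1) b(1) by (intro bexI[of _ "(a, b)"]) (auto simp: direct_sum_def)
  qed
  have nonneg: "0 \<le> nrm A (fst x)" "0 \<le> nrm B (snd x)" if "x \<in> car ?D" for x
    using that A.nrm_nonneg B.nrm_nonneg by (auto simp: direct_sum_def)
  show ?thesis
  proof (intro metric_cstar_algebra.intro cstar_algebra.intro MD.Metric_space_axioms \<open>MD.mcomplete\<close>)
    fix x y c assume x: "x \<in> car ?D"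
    show "sub ?D x x = zer ?D"
      using x by (simp add: direct_sum_sub) (auto simp: direct_sum_def A.sub_self B.sub_self)
    show "0 \<le> nrm ?D x"
      using nonneg[OF x] by (simp add: direct_sum_def)
    show "nrm ?D x = 0 \<longleftrightarrow> x = zer ?D"
    proof -
      have "nrm ?D x = 0 \<longleftrightarrow> nrm A (fst x) = 0 \<and> nrm B (snd x) = 0"
        using nonneg[OF x] by (simp add: direct_sum_def) linarith
      then show ?thesis
        using x by (auto simp: direct_sum_def A.nrm_eq_0 B.nrm_eq_0)
    qed
    show "nrm ?D (scl ?D c x) = cmod c * nrm ?D x"
      using x max_of_mono[of "(*) (cmod c)"]
      by (auto simp: direct_sum_def A.nrm_scl B.nrm_scl mono_def mult_left_mono)
    have "max (a\<^sup>2) (b\<^sup>2) = (max a b)\<^sup>2" if "0 \<le> a" "0 \<le> b" for a b :: real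
      using that power_mono[of a b 2] power_mono[of b a 2] by (auto simp: max_def intro: antisym)
    then show "nrm ?D (mul ?D (adj ?D x) x) = (nrm ?D x)\<^sup>2"
      using x nonneg[OF x] by (auto simp: direct_sum_def A.cstar_identity B.cstar_identity)
    assume y: "y \<in> car ?D"
    show "nrm ?D (add ?D x y) \<le> nrm ?D x + nrm ?D y"
      using x y A.nrm_triangle[of "fst x" "fst y"] B.nrm_triangle[of "snd x" "snd y"]
      by (auto simp: direct_sum_def)
    have "nrm A (mul A (fst x) (fst y)) \<le> nrm ?D x * nrm ?D y"
      using x y nonneg[OF x] nonneg[OF y]
      by (intro order_trans[OF A.nrm_mul mult_mono]) (auto simp: direct_sum_def)
    moreover have "nrm B (mul B (snd x) (snd y)) \<le> nrm ?D x * nrm ?D y"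
      using x y nonneg[OF x] nonneg[OF y]
      by (intro order_trans[OF B.nrm_mul mult_mono]) (auto simp: direct_sum_def)
    ultimately show "nrm ?D (mul ?D x y) \<le> nrm ?D x * nrm ?D y"
      by (simp add: direct_sum_def)
  qed (auto simp: direct_sum_def A.closed B.closed A.add_assoc B.add_assoc
      A.zer_add B.zer_add A.scl_add_left B.scl_add_left A.scl_add_right B.scl_add_right
      A.scl_scl B.scl_scl A.scl_one B.scl_one A.mul_assoc B.mul_assoc
      A.mul_add_left B.mul_add_left A.mul_add_right B.mul_add_right
      A.mul_scl_left B.mul_scl_left A.mul_scl_right B.mul_scl_right
      A.adj_add B.adj_add A.adj_scl B.adj_scl A.adj_mul B.adj_mul A.adj_adj B.adj_adj
      intro: A.add_comm B.add_comm)
qed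

text \<open>
  A closed subset of a complete space is complete; all other axioms are inherited from the larger carrier.
\<close>

lemma metric_cstar_algebra_closed_subalgebra:
  fixes A :: "'a cstar"
  assumes "metric_cstar_algebra A" and S: "star_subalgebra A S"
    and closed: "\<And>x. x \<in> car A \<Longrightarrow> (\<And>\<epsilon>. \<epsilon> > 0 \<Longrightarrow> \<exists>s\<in>S. nrm A (sub A x s) < \<epsilon>) \<Longrightarrow> x \<in> S"
  shows "metric_cstar_algebra (A\<lparr>car := S\<rparr>)"
proof -
  interpret A: metric_cstar_algebra A by fact
  have sub_eq: "sub (A\<lparr>car := S\<rparr>) = sub A" by (simp add: sub_def fun_eq_iff)
  have S_car: "x \<in> car A" if "x \<in> S" for x using S that by (auto simp: star_subalgebra_def)
  interpret MS: Metric_space S "\<lambda>x y. nrm A (sub A x y)"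
    using S_car by (intro A.subspace) auto
  have "MS.mcomplete"
    unfolding MS.mcomplete_iff
  proof (intro allI impI)
    fix \<sigma> assume "MS.MCauchy \<sigma>"
    then have \<sigma>: "range \<sigma> \<subseteq> S" and "A.MCauchy \<sigma>"
      using S_car by (auto simp: MS.MCauchy_def A.MCauchy_def)
    then obtain l where l: "l \<in> car A" "(\<lambda>k. nrm A (sub A (\<sigma> k) l)) \<longlonglongrightarrow> 0"
      using A.complete unfolding A.mcomplete_iff by blast
    have "l \<in> S"
    proof (rule closed[OF l(1)])
      fix \<epsilon> :: real assume "\<epsilon> > 0"
      then obtain k where "nrm A (sub A (\<sigma> k) l) < \<epsilon>"
        using order_tendstoD(2)[OF l(2)] eventually_happens by force
      then show "\<exists>s\<in>S. nrm A (sub A l s) < \<epsilon>"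
        using \<sigma> A.commute by (intro bexI[of _ "\<sigma> k"]) auto
    qed
    with l(2) show "\<exists>l\<in>S. (\<lambda>k. nrm A (sub A (\<sigma> k) l)) \<longlonglongrightarrow> 0" by blast
  qed
  then show ?thesis
    using S S_car
    by (intro metric_cstar_algebra.intro cstar_algebra.intro)
      (auto simp: sub_eq star_subalgebra_def MS.Metric_space_axioms A.add_assoc A.zer_add A.sub_self
        A.scl_add_left A.scl_add_right A.scl_scl A.scl_one A.mul_assoc
        A.mul_add_left A.mul_add_right A.mul_scl_left A.mul_scl_right
        A.adj_add A.adj_scl A.adj_mul A.adj_adj A.nrm_nonneg A.nrm_eq_0 A.nrm_triangle A.nrm_scl
        A.nrm_mul A.cstar_identity intro: A.add_comm)
qed


section \<open>The C*-algebra of functions vanishing at infinity\<close>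

text \<open>
  The supremum of an unbounded set of reals is an unspecified number, which may be negative.  The absolute
  value makes the distance nonnegative on all functions and changes nothing on the carrier, where the
  functions are bounded.
\<close>

definition C0_abs :: "'m topology \<Rightarrow> ('m \<Rightarrow> complex) cstar" where
  "C0_abs X = (C0 X)\<lparr>nrm := \<lambda>f. \<bar>nrm (C0 X) f\<bar>\<rparr>"

lemma C0_selectors [simp]:
  "zer (C0 X) = (\<lambda>x. 0)" "add (C0 X) f g = (\<lambda>x. f x + g x)" "scl (C0 X) c f = (\<lambda>x. c * f x)"
  "mul (C0 X) f g = (\<lambda>x. f x * g x)" "adj (C0 X) f = (\<lambda>x. cnj (f x))"
  "nrm (C0 X) f = (SUP x\<in>topspace X. cmod (f x))" "sub (C0 X) f g = (\<lambda>x. f x - g x)"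
  by (simp_all add: C0_def sub_def)

lemma C0_abs_selectors [simp]:
  "car (C0_abs X) = car (C0 X)" "zer (C0_abs X) = (\<lambda>x. 0)"
  "add (C0_abs X) f g = (\<lambda>x. f x + g x)" "scl (C0_abs X) c f = (\<lambda>x. c * f x)"
  "mul (C0_abs X) f g = (\<lambda>x. f x * g x)" "adj (C0_abs X) f = (\<lambda>x. cnj (f x))"
  "sub (C0_abs X) f g = (\<lambda>x. f x - g x)"
  "nrm (C0_abs X) f = \<bar>SUP x\<in>topspace X. cmod (f x)\<bar>"
  by (simp_all add: C0_abs_def sub_def)

lemma mem_C0_iff:
  "f \<in> car (C0 X) \<longleftrightarrow> (\<forall>x. x \<notin> topspace X \<longrightarrow> f x = 0) \<and> continuous_map X euclidean f \<and>
     (\<forall>\<epsilon>>0. \<exists>K. compactin X K \<and> (\<forall>x\<in>topspace X - K. cmod (f x) < \<epsilon>))"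
  by (simp add: C0_def)

lemma C0_bounded:
  assumes "f \<in> car (C0 X)"
  obtains C where "C > 0" "\<And>x. cmod (f x) \<le> C"
proof -
  obtain K where K: "compactin X K" "\<And>x. x \<in> topspace X - K \<Longrightarrow> cmod (f x) < 1"
    using assms unfolding mem_C0_iff by (meson zero_less_one)
  have "compact (f ` K)"
    using image_compactin[OF K(1), of euclidean f] assms by (simp add: mem_C0_iff)
  then obtain C where C: "\<And>x. x \<in> K \<Longrightarrow> cmod (f x) \<le> C"
    using compact_imp_bounded by (metis bounded_pos imageI)
  have "cmod (f x) \<le> max C 1" for x
  proof (cases "x \<in> topspace X")
    case True
    then show ?thesis using K(2)[of x] C[of x] by fastforce
  next
    case False
    then show ?thesis using assms by (simp add: mem_C0_iff)
  qed
  then show ?thesis by (intro that[of "max C 1"]) auto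
qed

lemma C0_nrm_ge:
  assumes "f \<in> car (C0 X)" "x \<in> topspace X"
  shows "cmod (f x) \<le> nrm (C0 X) f"
proof -
  obtain C where "\<And>x. cmod (f x) \<le> C" by (rule C0_bounded[OF assms(1)]) blast
  then have "bdd_above ((\<lambda>x. cmod (f x)) ` topspace X)" by (intro bdd_aboveI2)
  then show ?thesis using cSUP_upper[OF assms(2)] by simp
qed

lemma C0_nrm_le:
  assumes "topspace X \<noteq> {}" "\<And>x. x \<in> topspace X \<Longrightarrow> cmod (f x) \<le> c"
  shows "nrm (C0 X) f \<le> c"
  using cSUP_least[OF assms] by simp

lemma C0_nrm_nonneg:
  assumes "topspace X \<noteq> {}" "f \<in> car (C0 X)"
  shows "0 \<le> nrm (C0 X) f"
  using assms C0_nrm_ge[OF assms(2)] norm_ge_zero order_trans by (metis all_not_in_conv)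

lemma C0_abs_nrm:
  assumes "topspace X \<noteq> {}" "f \<in> car (C0 X)"
  shows "nrm (C0_abs X) f = nrm (C0 X) f"
  using C0_nrm_nonneg[OF assms] by simp

text \<open>
  Gives closure under scalar multiplication, under multiplication (one factor is bounded) and under
  conjugation.
\<close>

lemma C0_dominated:
  assumes f: "f \<in> car (C0 X)" and g: "continuous_map X euclidean g" and "C > 0"
    and le: "\<And>x. cmod (g x) \<le> C * cmod (f x)"
  shows "g \<in> car (C0 X)"
  unfolding mem_C0_iff
proof (intro conjI allI impI g)
  show "g x = 0" if "x \<notin> topspace X" for x
    using f le[of x] that by (simp add: mem_C0_iff)
  fix \<epsilon> :: real assume "\<epsilon> > 0"
  then have "\<epsilon> / C > 0" using \<open>C > 0\<close> by simp
  then obtain K where K: "compactin X K" "\<forall>x\<in>topspace X - K. cmod (f x) < \<epsilon> / C"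
    using f unfolding mem_C0_iff by blast
  have "cmod (g x) < \<epsilon>" if "x \<in> topspace X - K" for x
  proof -
    have "cmod (f x) < \<epsilon> / C" using K(2) that by blast
    then show ?thesis using le[of x] \<open>C > 0\<close> by (simp add: field_simps)
  qed
  with K(1) show "\<exists>K. compactin X K \<and> (\<forall>x\<in>topspace X - K. cmod (g x) < \<epsilon>)" by blast
qed

lemma C0_add_closed:
  assumes f: "f \<in> car (C0 X)" and g: "g \<in> car (C0 X)"
  shows "(\<lambda>x. f x + g x) \<in> car (C0 X)"
  unfolding mem_C0_iff
proof (intro conjI allI impI)
  show "continuous_map X euclidean (\<lambda>x. f x + g x)"
    using f g by (simp add: mem_C0_iff continuous_map_atin tendsto_add)
  show "f x + g x = 0" if "x \<notin> topspace X" for x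
    using f g that by (simp add: mem_C0_iff)
  fix \<epsilon> :: real assume "\<epsilon> > 0"
  then have "\<epsilon> / 2 > 0" by simp
  obtain K where K: "compactin X K" "\<forall>x\<in>topspace X - K. cmod (f x) < \<epsilon> / 2"
    using f \<open>\<epsilon> / 2 > 0\<close> unfolding mem_C0_iff by blast
  obtain L where L: "compactin X L" "\<forall>x\<in>topspace X - L. cmod (g x) < \<epsilon> / 2"
    using g \<open>\<epsilon> / 2 > 0\<close> unfolding mem_C0_iff by blast
  have "cmod (f x + g x) < \<epsilon>" if "x \<in> topspace X - (K \<union> L)" for x
  proof -
    have "cmod (f x) < \<epsilon> / 2" "cmod (g x) < \<epsilon> / 2" using K(2) L(2) that by auto
    then show ?thesis using norm_triangle_ineq[of "f x" "g x"] by simp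
  qed
  with compactin_Un[OF K(1) L(1)]
  show "\<exists>K. compactin X K \<and> (\<forall>x\<in>topspace X - K. cmod (f x + g x) < \<epsilon>)" by blast
qed

lemma C0_scl_closed:
  assumes f: "f \<in> car (C0 X)"
  shows "(\<lambda>x. c * f x) \<in> car (C0 X)"
proof (rule C0_dominated[OF f, of _ "cmod c + 1"])
  show "continuous_map X euclidean (\<lambda>x. c * f x)"
    using f by (simp add: mem_C0_iff continuous_map_atin tendsto_mult_left)
qed (auto simp: norm_mult add_nonneg_pos intro!: mult_right_mono)

lemma C0_mul_closed:
  assumes f: "f \<in> car (C0 X)" and g: "g \<in> car (C0 X)"
  shows "(\<lambda>x. f x * g x) \<in> car (C0 X)"
proof -
  obtain C where "C > 0" "\<And>x. cmod (f x) \<le> C" by (rule C0_bounded[OF f]) blast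
  moreover have "continuous_map X euclidean (\<lambda>x. f x * g x)"
    using f g by (simp add: mem_C0_iff continuous_map_atin tendsto_mult)
  ultimately show ?thesis
    by (intro C0_dominated[OF g, of _ C]) (auto simp: norm_mult intro!: mult_right_mono)
qed

lemma C0_adj_closed:
  assumes f: "f \<in> car (C0 X)"
  shows "(\<lambda>x. cnj (f x)) \<in> car (C0 X)"
proof (rule C0_dominated[OF f, of _ 1])
  show "continuous_map X euclidean (\<lambda>x. cnj (f x))"
    using f by (simp add: mem_C0_iff continuous_map_atin tendsto_cnj)
qed auto

lemma C0_uniformly_closed:
  assumes \<sigma>: "\<And>k. \<sigma> k \<in> car (C0 X)" and l0: "\<And>x. x \<notin> topspace X \<Longrightarrow> l x = 0"
    and lim: "\<And>\<epsilon>. \<epsilon> > 0 \<Longrightarrow> \<forall>\<^sub>F k in sequentially. \<forall>x\<in>topspace X. dist (\<sigma> k x) (l x) < \<epsilon>"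
  shows "l \<in> car (C0 X)"
  unfolding mem_C0_iff
proof (intro conjI allI impI l0)
  have "continuous_map X Met_TC.mtopology l"
    by (rule Met_TC.continuous_map_uniform_limit[where F = sequentially and f = \<sigma>])
      (use \<sigma> lim in \<open>auto simp: mem_C0_iff\<close>)
  then show "continuous_map X euclidean l" by simp
  fix \<epsilon> :: real assume "\<epsilon> > 0"
  then have "\<epsilon> / 2 > 0" by simp
  then obtain k where k: "\<forall>x\<in>topspace X. dist (\<sigma> k x) (l x) < \<epsilon> / 2"
    using eventually_happens[OF lim[OF \<open>\<epsilon> / 2 > 0\<close>]] by auto
  obtain K where K: "compactin X K" "\<forall>x\<in>topspace X - K. cmod (\<sigma> k x) < \<epsilon> / 2"
    using \<sigma>[of k] \<open>\<epsilon> / 2 > 0\<close> unfolding mem_C0_iff by blast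
  have "cmod (l x) < \<epsilon>" if "x \<in> topspace X - K" for x
  proof -
    have "cmod (\<sigma> k x) < \<epsilon> / 2" "dist (\<sigma> k x) (l x) < \<epsilon> / 2" using K(2) k that by auto
    then show ?thesis using norm_triangle_ineq2[of "l x" "\<sigma> k x"] by (simp add: dist_norm norm_minus_commute)
  qed
  with K(1) show "\<exists>K. compactin X K \<and> (\<forall>x\<in>topspace X - K. cmod (l x) < \<epsilon>)" by blast
qed

text \<open>
  For completeness, a Cauchy sequence in the supremum norm is uniformly Cauchy, so it has a pointwise limit,
  to which it converges uniformly; the limit vanishes at infinity by \<open>C0_uniformly_closed\<close>.
\<close>

lemma metric_cstar_algebra_C0_abs:
  fixes X :: "'m topology"
  assumes ne: "topspace X \<noteq> {}"
  shows "metric_cstar_algebra (C0_abs X)"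
proof -
  let ?A = "C0_abs X"
  let ?d = "\<lambda>f g. nrm ?A (sub ?A f g)"
  have sub_closed: "(\<lambda>x. f x - g x) \<in> car (C0 X)" if "f \<in> car (C0 X)" "g \<in> car (C0 X)" for f g
    using C0_add_closed[OF that(1) C0_scl_closed[OF that(2), of "- 1"]] by simp
  note closed = sub_closed C0_add_closed C0_scl_closed C0_mul_closed C0_adj_closed
  have zero: "(\<lambda>x. 0) \<in> car (C0 X)"
    by (auto simp: mem_C0_iff intro: exI[of _ "{}"])
  note nrm = C0_abs_nrm[OF ne]
  note ge = C0_nrm_ge[where X = X]
  note le = C0_nrm_le[OF ne]
  have triangle: "nrm ?A (\<lambda>x. f x + g x) \<le> nrm ?A f + nrm ?A g" if "f \<in> car (C0 X)" "g \<in> car (C0 X)" for f g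
  proof -
    have "nrm (C0 X) (\<lambda>x. f x + g x) \<le> nrm (C0 X) f + nrm (C0 X) g"
      using that by (intro le norm_triangle_mono ge)
    then show ?thesis using that by (simp only: nrm closed)
  qed
  have eq_0: "nrm ?A f = 0 \<longleftrightarrow> f = (\<lambda>x. 0)" if f: "f \<in> car (C0 X)" for f
  proof
    assume "nrm ?A f = 0"
    then have "f x = 0" if "x \<in> topspace X" for x
      using ge[OF f that] nrm[OF f] by simp
    then show "f = (\<lambda>x. 0)" using f by (auto simp: mem_C0_iff fun_eq_iff)
  qed (use ne in auto)
  interpret M: Metric_space "car ?A" ?d
  proof
    fix f g h :: "'m \<Rightarrow> complex"
    show "0 \<le> ?d f g" by simp
    show "?d f g = ?d g f" by (simp add: norm_minus_commute)
    show "(?d f g = 0) = (f = g)" if "f \<in> car ?A" "g \<in> car ?A"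
      using eq_0[of "\<lambda>x. f x - g x"] that by (simp add: closed fun_eq_iff del: C0_abs_selectors(8))
    show "?d f h \<le> ?d f g + ?d g h" if "f \<in> car ?A" "g \<in> car ?A" "h \<in> car ?A"
      using triangle[of "\<lambda>x. f x - g x" "\<lambda>x. g x - h x"] that by (simp add: closed del: C0_abs_selectors(8))
  qed
  have "M.mcomplete"
    unfolding M.mcomplete_iff
  proof (intro allI impI)
    fix \<sigma> assume cauchy: "M.MCauchy \<sigma>"
    then have \<sigma>: "\<sigma> k \<in> car (C0 X)" for k
      unfolding M.MCauchy_def by auto
    have unif: "\<exists>N. \<forall>m\<ge>N. \<forall>k\<ge>N. \<forall>x\<in>topspace X. dist (\<sigma> m x) (\<sigma> k x) < \<epsilon>" if "\<epsilon> > 0" for \<epsilon>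
    proof -
      have "\<forall>\<epsilon>>0. \<exists>N. \<forall>m k. N \<le> m \<longrightarrow> N \<le> k \<longrightarrow> ?d (\<sigma> m) (\<sigma> k) < \<epsilon>"
        using cauchy unfolding M.MCauchy_def by (rule conjunct2)
      then obtain N where N: "\<forall>m k. N \<le> m \<longrightarrow> N \<le> k \<longrightarrow> ?d (\<sigma> m) (\<sigma> k) < \<epsilon>"
        using \<open>\<epsilon> > 0\<close> by blast
      have "dist (\<sigma> m x) (\<sigma> k x) < \<epsilon>" if "m \<ge> N" "k \<ge> N" "x \<in> topspace X" for m k x
      proof -
        have "?d (\<sigma> m) (\<sigma> k) < \<epsilon>" using N that by blast
        moreover have "dist (\<sigma> m x) (\<sigma> k x) \<le> ?d (\<sigma> m) (\<sigma> k)"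
          using ge[OF sub_closed[OF \<sigma> \<sigma>] \<open>x \<in> topspace X\<close>, of m k] nrm[OF sub_closed[OF \<sigma> \<sigma>], of m k]
          by (simp add: dist_norm)
        ultimately show ?thesis by simp
      qed
      then show ?thesis by blast
    qed
    define l where "l x = (if x \<in> topspace X then lim (\<lambda>k. \<sigma> k x) else 0)" for x
    have pointwise: "(\<lambda>k. \<sigma> k x) \<longlonglongrightarrow> l x" if x: "x \<in> topspace X" for x
    proof -
      have "Cauchy (\<lambda>k. \<sigma> k x)"
        unfolding Cauchy_def using unif x by meson
      then show ?thesis
        using x by (simp add: l_def Cauchy_convergent_iff convergent_LIMSEQ_iff)
    qed
    have lim: "\<forall>\<^sub>F k in sequentially. \<forall>x\<in>topspace X. dist (\<sigma> k x) (l x) \<le> \<epsilon>" if \<epsilon>: "\<epsilon> > 0" for \<epsilon>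
    proof -
      obtain N where N: "\<forall>m\<ge>N. \<forall>k\<ge>N. \<forall>x\<in>topspace X. dist (\<sigma> m x) (\<sigma> k x) < \<epsilon>"
        using unif[OF \<epsilon>] by blast
      have "dist (\<sigma> m x) (l x) \<le> \<epsilon>" if "m \<ge> N" "x \<in> topspace X" for m x
      proof (rule tendsto_upperbound)
        show "(\<lambda>k. dist (\<sigma> m x) (\<sigma> k x)) \<longlonglongrightarrow> dist (\<sigma> m x) (l x)"
          by (intro tendsto_dist tendsto_const pointwise that)
        show "\<forall>\<^sub>F k in sequentially. dist (\<sigma> m x) (\<sigma> k x) \<le> \<epsilon>"
          unfolding eventually_sequentially using N that less_imp_le by blast
      qed simp
      then show ?thesis unfolding eventually_sequentially by blast
    qed
    have l: "l \<in> car (C0 X)"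
    proof (rule C0_uniformly_closed[OF \<sigma>])
      fix \<epsilon> :: real assume "\<epsilon> > 0"
      then show "\<forall>\<^sub>F k in sequentially. \<forall>x\<in>topspace X. dist (\<sigma> k x) (l x) < \<epsilon>"
        using lim[of "\<epsilon> / 2"] by (auto elim!: eventually_mono)
    qed (simp add: l_def)
    have "(\<lambda>k. ?d (\<sigma> k) l) \<longlonglongrightarrow> 0"
    proof (rule tendstoI)
      fix \<epsilon> :: real assume "\<epsilon> > 0"
      then have "\<forall>\<^sub>F k in sequentially. \<forall>x\<in>topspace X. dist (\<sigma> k x) (l x) \<le> \<epsilon> / 2"
        by (intro lim) simp
      then show "\<forall>\<^sub>F k in sequentially. dist (?d (\<sigma> k) l) 0 < \<epsilon>"
      proof eventually_elim
        case (elim k)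
        then have "nrm (C0 X) (\<lambda>x. \<sigma> k x - l x) \<le> \<epsilon> / 2"
          by (intro le) (simp add: dist_norm)
        then show ?case
          using nrm[OF sub_closed[OF \<sigma> l], of k] \<open>\<epsilon> > 0\<close> by simp
      qed
    qed
    with l show "\<exists>l\<in>car ?A. (\<lambda>k. ?d (\<sigma> k) l) \<longlonglongrightarrow> 0" by auto
  qed
  show ?thesis
  proof (intro metric_cstar_algebra.intro cstar_algebra.intro M.Metric_space_axioms \<open>M.mcomplete\<close>)
    fix f g :: "'m \<Rightarrow> complex" and c assume f: "f \<in> car ?A"
    then have f': "f \<in> car (C0 X)" by simp
    show "nrm ?A f = 0 \<longleftrightarrow> f = zer ?A"
      using eq_0[OF f'] by simp
    show "nrm ?A (scl ?A c f) = cmod c * nrm ?A f"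
    proof (rule antisym)
      have "nrm (C0 X) (\<lambda>x. c * f x) \<le> cmod c * nrm (C0 X) f"
        by (intro le) (simp add: norm_mult mult_left_mono ge[OF f', simplified])
      then show "nrm ?A (scl ?A c f) \<le> cmod c * nrm ?A f"
        using nrm f' by (simp only: closed C0_abs_selectors(4))
      show "cmod c * nrm ?A f \<le> nrm ?A (scl ?A c f)"
      proof (cases "c = 0")
        case False
        have "nrm (C0 X) f \<le> nrm (C0 X) (\<lambda>x. c * f x) / cmod c"
          using ge[OF C0_scl_closed[OF f'], of _ c] False
          by (intro le) (simp add: norm_mult field_simps del: C0_selectors)
        then have "cmod c * nrm (C0 X) f \<le> nrm (C0 X) (\<lambda>x. c * f x)"
          using False by (simp add: field_simps del: C0_selectors)
        then show ?thesis
          using nrm f' by (simp only: closed C0_abs_selectors(4))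
      qed simp
    qed
    show "nrm ?A (mul ?A (adj ?A f) f) = (nrm ?A f)\<^sup>2"
    proof -
      let ?g = "\<lambda>x. cnj (f x) * f x"
      have g: "?g \<in> car (C0 X)" using f' by (intro closed)
      have sq: "cmod (cnj (f x) * f x) = (cmod (f x))\<^sup>2" for x
        by (simp add: norm_mult power2_eq_square)
      have "nrm (C0 X) ?g \<le> (nrm (C0 X) f)\<^sup>2"
        by (intro le) (auto simp: sq intro!: power_mono ge[OF f', simplified])
      moreover have "nrm (C0 X) f \<le> sqrt (nrm (C0 X) ?g)"
        using ge[OF g] by (intro le) (auto simp: sq intro!: real_le_rsqrt)
      then have "(nrm (C0 X) f)\<^sup>2 \<le> nrm (C0 X) ?g"
        using C0_nrm_nonneg[OF ne f'] C0_nrm_nonneg[OF ne g]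
        by (metis power_mono real_sqrt_pow2)
      ultimately show ?thesis
        using nrm[OF g] nrm[OF f'] by (simp del: C0_abs_selectors(8) C0_selectors)
    qed
    assume g: "g \<in> car ?A"
    then have g': "g \<in> car (C0 X)" by simp
    show "nrm ?A (add ?A f g) \<le> nrm ?A f + nrm ?A g"
      using triangle[OF f' g'] by simp
    have "nrm (C0 X) (\<lambda>x. f x * g x) \<le> nrm (C0 X) f * nrm (C0 X) g"
      unfolding norm_mult
      by (intro le order_trans[OF norm_mult_ineq] mult_mono ge f' g' C0_nrm_nonneg ne) auto
    then show "nrm ?A (mul ?A f g) \<le> nrm ?A f * nrm ?A g"
      using nrm f' g' by (simp only: closed C0_abs_selectors(5))
  qed (auto simp: closed zero algebra_simps)
qed


section \<open>Continuous fields of subalgebras of one C*-algebra\<close>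

context cstar_algebra
begin

definition continuous_sections :: "real set \<Rightarrow> (real \<Rightarrow> 'b set) \<Rightarrow> (real \<Rightarrow> 'b) set" where
  "continuous_sections T F =
    {x. \<forall>t\<in>T. x t \<in> F t \<and> ((\<lambda>s. nrm A (x s \<ominus> x t)) \<longlongrightarrow> 0) (at t within T)}"

lemma continuous_sectionsI:
  assumes F: "\<And>t. t \<in> T \<Longrightarrow> F t \<subseteq> car A" and z: "\<And>t. t \<in> T \<Longrightarrow> z t \<in> F t"
    and bound: "\<And>s t. s \<in> T \<Longrightarrow> t \<in> T \<Longrightarrow> nrm A (z s \<ominus> z t) \<le> b t s"
    and lim: "\<And>t. t \<in> T \<Longrightarrow> (b t \<longlongrightarrow> 0) (at t within T)"
  shows "z \<in> continuous_sections T F"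
proof -
  have "((\<lambda>s. nrm A (z s \<ominus> z t)) \<longlongrightarrow> 0) (at t within T)" if t: "t \<in> T" for t
  proof (rule Lim_null_comparison[OF _ lim[OF t]])
    have "\<forall>\<^sub>F s in at t within T. s \<in> T" by (simp add: eventually_at_filter)
    then show "\<forall>\<^sub>F s in at t within T. norm (nrm A (z s \<ominus> z t)) \<le> b t s"
    proof eventually_elim
      case (elim s)
      then have "z s \<ominus> z t \<in> car A" using z F t by (blast intro: sub_closed)
      then show ?case using bound[OF elim t] nrm_nonneg by simp
    qed
  qed
  with z show ?thesis by (simp add: continuous_sections_def)
qed

text \<open>
  Inside one algebra, continuity of a section is continuity of a function into a normed space, so closure
  under the operations and continuity of the norm are the usual estimates, and local approximability is the
  fact that a locally uniform limit of continuous functions is continuous.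
\<close>

lemma continuous_field_of_subalgebras:
  assumes F: "\<And>t. t \<in> T \<Longrightarrow> star_subalgebra A (F t)"
    and fibres: "\<And>t. t \<in> T \<Longrightarrow> cstar_algebra (A\<lparr>car := F t\<rparr>)"
    and through: "\<And>t a. t \<in> T \<Longrightarrow> a \<in> F t \<Longrightarrow> \<exists>x\<in>continuous_sections T F. x t = a"
  shows "continuous_field T (\<lambda>t. A\<lparr>car := F t\<rparr>) (continuous_sections T F)"
proof -
  let ?\<Gamma> = "continuous_sections T F"
  have sub_eq: "sub (A\<lparr>car := S\<rparr>) = sub A" for S by (simp add: sub_def fun_eq_iff)
  have F_car: "F t \<subseteq> car A" if "t \<in> T" for t using F[OF that] by (simp add: star_subalgebra_def)
  have mem: "x t \<in> F t" "x t \<in> car A" if "x \<in> ?\<Gamma>" "t \<in> T" for x t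
    using that F_car by (auto simp: continuous_sections_def)
  have lim: "((\<lambda>s. nrm A (x s \<ominus> x t)) \<longlongrightarrow> 0) (at t within T)" if "x \<in> ?\<Gamma>" "t \<in> T" for x t
    using that by (simp add: continuous_sections_def)
  note sectionI = continuous_sectionsI[OF F_car]
  have zer: "(\<lambda>t. \<zero>) \<in> ?\<Gamma>"
    by (rule sectionI[where b = "\<lambda>_ _. 0"])
      (use F in \<open>auto simp: star_subalgebra_def sub_self closed nrm_zer\<close>)
  have add: "(\<lambda>t. x t \<oplus> y t) \<in> ?\<Gamma>" if x: "x \<in> ?\<Gamma>" and y: "y \<in> ?\<Gamma>" for x y
  proof (rule sectionI)
    show "x t \<oplus> y t \<in> F t" if "t \<in> T" for t
      using mem x y F that by (auto simp: star_subalgebra_def)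
    show "nrm A ((x s \<oplus> y s) \<ominus> (x t \<oplus> y t)) \<le> nrm A (x s \<ominus> x t) + nrm A (y s \<ominus> y t)"
      if "s \<in> T" "t \<in> T" for s t
      using that mem[OF x] mem[OF y] by (simp add: add_sub_add nrm_triangle sub_closed)
    show "((\<lambda>s. nrm A (x s \<ominus> x t) + nrm A (y s \<ominus> y t)) \<longlongrightarrow> 0) (at t within T)" if "t \<in> T" for t
      using tendsto_add[OF lim[OF x that] lim[OF y that]] by simp
  qed
  have scl: "(\<lambda>t. c \<odot> x t) \<in> ?\<Gamma>" if x: "x \<in> ?\<Gamma>" for x c
  proof (rule sectionI)
    show "c \<odot> x t \<in> F t" if "t \<in> T" for t
      using mem x F that by (auto simp: star_subalgebra_def)
    show "nrm A ((c \<odot> x s) \<ominus> (c \<odot> x t)) \<le> cmod c * nrm A (x s \<ominus> x t)" if "s \<in> T" "t \<in> T" for s t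
      using that mem[OF x] by (simp add: scl_sub[symmetric] nrm_scl sub_closed)
    show "((\<lambda>s. cmod c * nrm A (x s \<ominus> x t)) \<longlongrightarrow> 0) (at t within T)" if "t \<in> T" for t
      using tendsto_mult_left[OF lim[OF x that], of "cmod c"] by simp
  qed
  have mul: "(\<lambda>t. x t \<otimes> y t) \<in> ?\<Gamma>" if x: "x \<in> ?\<Gamma>" and y: "y \<in> ?\<Gamma>" for x y
  proof (rule sectionI)
    show "x t \<otimes> y t \<in> F t" if "t \<in> T" for t
      using mem x y F that by (auto simp: star_subalgebra_def)
    let ?b = "\<lambda>t s. nrm A (x s \<ominus> x t) * (nrm A (y t) + nrm A (y s \<ominus> y t)) + nrm A (x t) * nrm A (y s \<ominus> y t)"
    show "nrm A (x s \<otimes> y s \<ominus> x t \<otimes> y t) \<le> ?b t s" if "s \<in> T" "t \<in> T" for s t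
    proof -
      note xy = mem(2)[OF x that(1)] mem(2)[OF x that(2)] mem(2)[OF y that(1)] mem(2)[OF y that(2)]
      have "nrm A (x s \<otimes> y s \<ominus> x t \<otimes> y t) \<le>
          nrm A ((x s \<ominus> x t) \<otimes> y s) + nrm A (x t \<otimes> (y s \<ominus> y t))"
        using xy by (simp add: mul_sub_mul nrm_triangle sub_closed closed)
      also have "\<dots> \<le> nrm A (x s \<ominus> x t) * nrm A (y s) + nrm A (x t) * nrm A (y s \<ominus> y t)"
        using xy by (intro add_mono nrm_mul) (simp_all add: sub_closed)
      also have "\<dots> \<le> ?b t s"
        using nrm_diff_le[OF xy(3,4)] nrm_nonneg[OF sub_closed[OF xy(1,2)]]
        by (intro add_right_mono mult_left_mono) auto
      finally show ?thesis .
    qed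
    show "(?b t \<longlongrightarrow> 0) (at t within T)" if "t \<in> T" for t
      using tendsto_add[OF tendsto_mult[OF lim[OF x that] tendsto_add[OF tendsto_const[of "nrm A (y t)"] lim[OF y that]]]
          tendsto_mult_left[OF lim[OF y that], of "nrm A (x t)"]]
      by simp
  qed
  have adj: "(\<lambda>t. adj A (x t)) \<in> ?\<Gamma>" if x: "x \<in> ?\<Gamma>" for x
  proof (rule sectionI)
    show "adj A (x t) \<in> F t" if "t \<in> T" for t
      using mem x F that by (auto simp: star_subalgebra_def)
    show "nrm A (adj A (x s) \<ominus> adj A (x t)) \<le> nrm A (x s \<ominus> x t)" if "s \<in> T" "t \<in> T" for s t
      using that mem[OF x] by (simp add: adj_sub[symmetric] nrm_adj sub_closed)
    show "((\<lambda>s. nrm A (x s \<ominus> x t)) \<longlongrightarrow> 0) (at t within T)" if "t \<in> T" for t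
      by (rule lim[OF x that])
  qed
  have local: "x \<in> ?\<Gamma>"
    if x: "\<And>t. t \<in> T \<Longrightarrow> x t \<in> F t"
      and approx: "\<And>t \<epsilon>. t \<in> T \<Longrightarrow> \<epsilon> > 0 \<Longrightarrow> \<exists>y\<in>?\<Gamma>. \<exists>U. open U \<and> t \<in> U \<and>
          (\<forall>s\<in>U \<inter> T. nrm A (x s \<ominus> y s) \<le> \<epsilon>)" for x
  proof -
    have "((\<lambda>s. nrm A (x s \<ominus> x t)) \<longlongrightarrow> 0) (at t within T)" if t: "t \<in> T" for t
    proof (rule tendstoI)
      fix \<epsilon> :: real assume "\<epsilon> > 0"
      then have "\<epsilon> / 3 > 0" by simp
      then obtain y U where y: "y \<in> ?\<Gamma>" and U: "open U" "t \<in> U"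
        and le: "\<forall>s\<in>U \<inter> T. nrm A (x s \<ominus> y s) \<le> \<epsilon> / 3"
        using approx[OF t] by blast
      have "\<forall>\<^sub>F s in at t within T. s \<in> U \<inter> T"
        using U by (auto simp: eventually_at_topological)
      moreover have "\<forall>\<^sub>F s in at t within T. nrm A (y s \<ominus> y t) < \<epsilon> / 3"
        using order_tendstoD(2)[OF lim[OF y t] \<open>\<epsilon> / 3 > 0\<close>] .
      ultimately show "\<forall>\<^sub>F s in at t within T. dist (nrm A (x s \<ominus> x t)) 0 < \<epsilon>"
      proof eventually_elim
        case (elim s)
        then have "s \<in> T" by simp
        have xc: "x s \<in> car A" "x t \<in> car A" using x F_car \<open>s \<in> T\<close> t by blast+
        note yc = mem(2)[OF y \<open>s \<in> T\<close>] mem(2)[OF y t]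
        have "nrm A (x s \<ominus> x t) \<le> nrm A (x s \<ominus> y s) + (nrm A (y s \<ominus> y t) + nrm A (y t \<ominus> x t))"
          using nrm_sub_triangle[OF xc(1) yc(1) xc(2)] nrm_sub_triangle[OF yc(1) yc(2) xc(2)] by simp
        moreover have "nrm A (x s \<ominus> y s) \<le> \<epsilon> / 3" "nrm A (y t \<ominus> x t) \<le> \<epsilon> / 3"
          using le elim U(2) t nrm_sub_commute[OF yc(2) xc(2)] by auto
        ultimately show ?case
          using elim(2) nrm_nonneg[OF sub_closed[OF xc]] by simp
      qed
    qed
    with x show ?thesis by (simp add: continuous_sections_def)
  qed
  show ?thesis
  proof (rule continuous_field.intro)
    fix t assume t: "t \<in> T"
    show "cstar_algebra (A\<lparr>car := F t\<rparr>)" by (rule fibres[OF t])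
    show "dense_in (A\<lparr>car := F t\<rparr>) ((\<lambda>x. x t) ` ?\<Gamma>)"
      unfolding dense_in_def
    proof (intro conjI ballI allI impI)
      show "(\<lambda>x. x t) ` ?\<Gamma> \<subseteq> car (A\<lparr>car := F t\<rparr>)" using mem t by auto
      fix a and \<epsilon> :: real assume a: "a \<in> car (A\<lparr>car := F t\<rparr>)" and "\<epsilon> > 0"
      then have a: "a \<in> F t" "a \<in> car A" using F_car[OF t] by auto
      obtain x where x: "x \<in> ?\<Gamma>" "x t = a" using through[OF t a(1)] by blast
      have "nrm A (a \<ominus> a) < \<epsilon>" using a(2) \<open>\<epsilon> > 0\<close> by (simp add: sub_self nrm_zer)
      with x show "\<exists>s\<in>(\<lambda>x. x t) ` ?\<Gamma>. nrm (A\<lparr>car := F t\<rparr>) (sub (A\<lparr>car := F t\<rparr>) a s) < \<epsilon>"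
        by (auto simp: sub_eq)
    qed
  next
    fix x assume x: "x \<in> ?\<Gamma>"
    show "continuous_on T (\<lambda>t. nrm (A\<lparr>car := F t\<rparr>) (x t))"
      unfolding continuous_on_def
    proof
      fix t assume t: "t \<in> T"
      have "\<forall>\<^sub>F s in at t within T. s \<in> T" by (simp add: eventually_at_filter)
      then have "\<forall>\<^sub>F s in at t within T. norm (nrm A (x s) - nrm A (x t)) \<le> nrm A (x s \<ominus> x t)"
        by eventually_elim (use mem(2)[OF x] t in \<open>auto intro: nrm_diff_le\<close>)
      then have "((\<lambda>s. nrm A (x s) - nrm A (x t)) \<longlongrightarrow> 0) (at t within T)"
        by (rule Lim_null_comparison[OF _ lim[OF x t]])
      then show "((\<lambda>t. nrm (A\<lparr>car := F t\<rparr>) (x t)) \<longlongrightarrow> nrm (A\<lparr>car := F t\<rparr>) (x t)) (at t within T)"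
        by (simp add: Lim_null[symmetric])
    qed
  next
    fix x assume "x \<in> (\<Pi> t\<in>T. car (A\<lparr>car := F t\<rparr>))"
      and "\<forall>t\<in>T. \<forall>\<epsilon>>0. \<exists>y\<in>?\<Gamma>. \<exists>U. open U \<and> t \<in> U \<and>
        (\<forall>s\<in>U \<inter> T. nrm (A\<lparr>car := F s\<rparr>) (sub (A\<lparr>car := F s\<rparr>) (x s) (y s)) \<le> \<epsilon>)"
    then show "x \<in> ?\<Gamma>"
      by (intro local) (auto simp: sub_eq)
  qed (use mem zer add scl mul adj in auto)
qed

end

text \<open>
  These are the fibres.  Removing the second summand at 0 makes the fibre there the classical algebra \<open>A\<close>.
\<close>

definition vanishing_summand :: "'a cstar \<Rightarrow> 'b cstar \<Rightarrow> real \<Rightarrow> ('a \<times> 'b) set" where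
  "vanishing_summand A B t = {x \<in> car (direct_sum A B). t = 0 \<longrightarrow> snd x = zer B}"

lemma star_subalgebra_vanishing_summand:
  assumes "cstar_algebra A" "cstar_algebra B"
  shows "star_subalgebra (direct_sum A B) (vanishing_summand A B t)"
proof -
  interpret A: cstar_algebra A by fact
  interpret B: cstar_algebra B by fact
  show ?thesis
    by (auto simp: star_subalgebra_def vanishing_summand_def direct_sum_def A.closed B.closed
        B.scl_zer B.zer_mul_zer B.adj_zer B.zer_add)
qed

text \<open>
  Sections through a given point are obtained by keeping the first component constant and letting the second
  one grow linearly from 0.
\<close>

lemma continuous_field_vanishing_summand:
  assumes A: "metric_cstar_algebra A" and B: "metric_cstar_algebra B"
  shows "continuous_field T (\<lambda>t. direct_sum A B\<lparr>car := vanishing_summand A B t\<rparr>)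
    (cstar_algebra.continuous_sections (direct_sum A B) T (vanishing_summand A B))"
proof -
  let ?D = "direct_sum A B" and ?F = "vanishing_summand A B"
  interpret A: metric_cstar_algebra A by fact
  interpret B: metric_cstar_algebra B by fact
  interpret D: metric_cstar_algebra ?D by (rule metric_cstar_algebra_direct_sum[OF A B])
  note F = star_subalgebra_vanishing_summand[OF A.cstar_algebra_axioms B.cstar_algebra_axioms]
  show ?thesis
  proof (rule D.continuous_field_of_subalgebras[OF F])
    fix t
    show "cstar_algebra (?D\<lparr>car := ?F t\<rparr>)"
    proof (intro metric_cstar_algebra.axioms(1) metric_cstar_algebra_closed_subalgebra[OF D.metric_cstar_algebra_axioms F])
      fix x assume x: "x \<in> car ?D" and approx: "\<And>\<epsilon>. \<epsilon> > 0 \<Longrightarrow> \<exists>s\<in>?F t. nrm ?D (sub ?D x s) < \<epsilon>"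
      have xB: "snd x \<in> car B" using x by (auto simp: direct_sum_def)
      have "snd x = zer B" if "t = 0"
      proof -
        have "nrm B (snd x) \<le> 0 + \<epsilon>" if "\<epsilon> > 0" for \<epsilon>
        proof -
          obtain s where "s \<in> ?F t" "nrm ?D (sub ?D x s) < \<epsilon>" using approx[OF \<open>\<epsilon> > 0\<close>] by blast
          then show ?thesis
            using xB \<open>t = 0\<close> by (simp add: direct_sum_sub vanishing_summand_def B.sub_zer) (simp add: direct_sum_def)
        qed
        then have "nrm B (snd x) \<le> 0" by (rule field_le_epsilon)
        then show ?thesis using B.nrm_nonneg[OF xB] B.nrm_eq_0[OF xB] by simp
      qed
      then show "x \<in> ?F t" using x by (simp add: vanishing_summand_def)
    qed
    fix a assume a: "a \<in> ?F t"
    then have aA: "fst a \<in> car A" and aB: "snd a \<in> car B"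
      by (auto simp: vanishing_summand_def direct_sum_def)
    \<comment> \<open>At \<open>s = 0\<close> the second component is zero, as it must be; at \<open>s = t\<close> it is that of \<open>a\<close>.  For \<open>t = 0\<close>
      the convention \<open>inverse 0 = 0\<close> makes it zero throughout, which is right because then \<open>snd a\<close> is zero.\<close>
    let ?z = "\<lambda>s. (fst a, scl B (complex_of_real (s * inverse t)) (snd a))"
    have "?z \<in> D.continuous_sections T ?F"
    proof (rule D.continuous_sectionsI)
      show "?F s \<subseteq> car ?D" for s by (auto simp: vanishing_summand_def)
      show "?z s \<in> ?F s" for s
        using aA aB by (auto simp: vanishing_summand_def direct_sum_def B.closed B.zero_scl)
      show "nrm ?D (sub ?D (?z s) (?z r)) \<le> \<bar>(s - r) * inverse t\<bar> * nrm B (snd a)" for s r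
      proof -
        define k where "k = (s - r) * inverse t"
        have "sub ?D (?z s) (?z r) = (zer A, scl B (complex_of_real k) (snd a))"
          using aA aB by (simp add: k_def direct_sum_sub A.sub_self B.scl_diff[symmetric] left_diff_distrib)
        moreover have "nrm ?D (zer A, scl B (complex_of_real k) (snd a)) = \<bar>k\<bar> * nrm B (snd a)"
          using aB B.nrm_nonneg[OF aB] by (simp add: direct_sum_def A.nrm_zer B.nrm_scl)
        ultimately show ?thesis by (simp add: k_def)
      qed
      have "((\<lambda>s. \<bar>(s - r) * inverse t\<bar> * nrm B (snd a)) \<longlongrightarrow> \<bar>(r - r) * inverse t\<bar> * nrm B (snd a)) (at r within T)" for r
        by (intro tendsto_intros)
      then show "((\<lambda>s. \<bar>(s - r) * inverse t\<bar> * nrm B (snd a)) \<longlongrightarrow> 0) (at r within T)" for r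
        by simp
    qed
    moreover have "?z t = a"
      using a aB by (cases "t = 0") (auto simp: vanishing_summand_def B.zero_scl B.scl_one prod_eq_iff)
    ultimately show "\<exists>x\<in>D.continuous_sections T ?F. x t = a" by (intro bexI[of _ ?z])
  qed
qed


section \<open>A faithful strict quantization with oversized fibres\<close>

theorem proposition2p7:
  fixes n :: nat and X :: "'m topology" and At :: "'m chart set"
  assumes "smooth_manifold n X At"
  shows "\<exists>(\<A> :: real \<Rightarrow> (('m \<Rightarrow> complex) \<times> ('m \<Rightarrow> complex)) cstar) \<Gamma> \<pi>.
    faithful_strict_quantization n X At (\<lambda>f g x. 0) {0..1} \<A> \<Gamma> (Cinf_c n X At) \<pi> \<and>
    \<not> (\<exists>B. B \<subseteq> Cinf_c n X At \<and> dense_star_subalgebra (C0 X) B \<and>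
         strict_deformation_quantization n X At (\<lambda>f g x. 0) {0..1} \<A> \<Gamma> B
           (\<lambda>h. restrict (\<pi> h) B))"
proof -
  interpret smooth_manifold n X At by fact
  let ?A = "C0_abs X"
  let ?D = "direct_sum ?A ?A" and ?F = "vanishing_summand ?A ?A"
  define \<A> where "\<A> h = ?D\<lparr>car := ?F h\<rparr>" for h
  define \<Gamma> where "\<Gamma> = cstar_algebra.continuous_sections ?D {0..1} ?F"
  define \<pi> :: "real \<Rightarrow> ('m \<Rightarrow> complex) \<Rightarrow> ('m \<Rightarrow> complex) \<times> ('m \<Rightarrow> complex)"
    where "\<pi> h f = (f, \<lambda>x. 0)" for h f
  have A: "metric_cstar_algebra ?A" by (rule metric_cstar_algebra_C0_abs[OF nonempty])
  interpret A: metric_cstar_algebra ?A by (rule A)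
  interpret D: metric_cstar_algebra ?D by (rule metric_cstar_algebra_direct_sum[OF A A])
  have zero: "(\<lambda>x. 0) \<in> car (C0 X)" using A.zer_closed by simp
  have C: "f \<in> car (C0 X)" if "f \<in> Cinf_c n X At" for f
    using that Cinf_c_subset_C0 by blast
  have zero_c: "(\<lambda>x. 0) \<in> Cinf_c n X At"
    using star_subalgebra_Cinf_c by (simp add: star_subalgebra_def)
  have \<A>_simps: "car (\<A> h) = ?F h" "zer (\<A> h) = zer ?D" "add (\<A> h) = add ?D" "scl (\<A> h) = scl ?D"
    "mul (\<A> h) = mul ?D" "adj (\<A> h) = adj ?D" "nrm (\<A> h) = nrm ?D" "sub (\<A> h) = sub ?D" for h
    by (simp_all add: \<A>_def sub_def fun_eq_iff)
  have \<pi>_F: "\<pi> h f \<in> ?F t" if "f \<in> car (C0 X)" for h f t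
    using that zero by (simp add: \<pi>_def vanishing_summand_def direct_sum_def)
  have quantization: "faithful_strict_quantization n X At (\<lambda>f g x. 0) {0..1} \<A> \<Gamma> (Cinf_c n X At) \<pi>"
  proof (intro faithful_strict_quantization.intro strict_quantization.intro poisson_manifold_zero
      strict_quantization_axioms.intro faithful_strict_quantization_axioms.intro
      dense_star_subalgebra_Cinf_c zero_c)
    show "continuous_field {0..1} \<A> \<Gamma>"
      unfolding \<A>_def \<Gamma>_def by (rule continuous_field_vanishing_summand[OF A A])
    show "closed {0..1::real}" "(0::real) \<in> {0..1}" by auto
    show "(0::real) islimpt {0..1}" by (simp add: islimpt_Icc)
    show "Cinf_c n X At \<subseteq> Cinf n X At" by (auto simp: Cinf_c_def)
    fix f g :: "'m \<Rightarrow> complex" and h :: real and c assume f: "f \<in> Cinf_c n X At"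
    show "\<pi> h f \<in> car (\<A> h)" using C[OF f] by (simp add: \<A>_simps \<pi>_F)
    show "\<pi> h (\<lambda>x. c * f x) = scl (\<A> h) c (\<pi> h f)"
      by (simp add: \<A>_simps direct_sum_def \<pi>_def)
    show "(\<lambda>h. \<pi> h f) \<in> \<Gamma>"
      unfolding \<Gamma>_def
    proof (rule D.continuous_sectionsI)
      show "nrm ?D (sub ?D (\<pi> s f) (\<pi> t f)) \<le> 0" for s t
        using nonempty by (simp add: direct_sum_sub \<pi>_def) (simp add: direct_sum_def)
    qed (use \<pi>_F[OF C[OF f]] in \<open>auto simp: vanishing_summand_def\<close>)
    assume g: "g \<in> Cinf_c n X At"
    show "\<pi> h (\<lambda>x. f x + g x) = add (\<A> h) (\<pi> h f) (\<pi> h g)"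
      by (simp add: \<A>_simps direct_sum_def \<pi>_def)
    have "nrm (\<A> h) (sub (\<A> h) (scl (\<A> h) (1 / (\<i> * complex_of_real h))
        (sub (\<A> h) (mul (\<A> h) (\<pi> h f) (\<pi> h g)) (mul (\<A> h) (\<pi> h g) (\<pi> h f)))) (\<pi> h (\<lambda>x. 0))) = 0" for h
      using nonempty unfolding \<A>_simps direct_sum_sub
      by (simp add: direct_sum_def \<pi>_def mult.commute)
    then show "((\<lambda>h. nrm (\<A> h) (sub (\<A> h) (scl (\<A> h) (1 / (\<i> * complex_of_real h))
        (sub (\<A> h) (mul (\<A> h) (\<pi> h f) (\<pi> h g)) (mul (\<A> h) (\<pi> h g) (\<pi> h f)))) (\<pi> h (\<lambda>x. 0))))
        \<longlongrightarrow> 0) (at 0 within {0..1})"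
      by simp
  next
    have "cstar_iso (\<A> 0) (C0 X) fst"
      using nonempty zero C0_nrm_nonneg[OF nonempty]
      by (auto simp: cstar_iso_def \<A>_simps vanishing_summand_def direct_sum_def bij_betw_def inj_on_def image_iff)
    then show "\<exists>\<iota>. cstar_iso (\<A> 0) (C0 X) \<iota> \<and> (\<forall>f\<in>Cinf_c n X At. \<iota> (\<pi> 0 f) = f)"
      by (intro exI[of _ fst]) (simp add: \<pi>_def)
    show "inj_on (\<pi> h) (Cinf_c n X At)" for h
      by (auto simp: inj_on_def \<pi>_def)
  qed
  have "\<not> dense_star_subalgebra (\<A> 1) (restrict (\<pi> 1) B ` B)" for B
  proof
    assume "dense_star_subalgebra (\<A> 1) (restrict (\<pi> 1) B ` B)"
    then have dense: "dense_in (\<A> 1) (restrict (\<pi> 1) B ` B)"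
      by (simp add: dense_star_subalgebra_def)
    \<comment> \<open>A nonzero function \<open>g\<close> exists because the manifold is nonempty; \<open>(0, g)\<close> cannot be approximated.\<close>
    obtain p where p: "p \<in> topspace X" using nonempty by blast
    obtain b :: "'m \<Rightarrow> real" and K where b: "smooth b" "\<And>x. b x \<ge> 0" "b p > 0"
      "compactin X K" "K \<subseteq> topspace X" "\<And>x. x \<notin> K \<Longrightarrow> b x = 0"
      by (rule exists_smooth_bump[OF openin_topspace p]) blast
    define g where "g x = complex_of_real (b x)" for x
    have "smooth g"
      unfolding g_def by (rule smooth_bounded_linear[OF bounded_linear_of_real b(1)])
    then have "g \<in> Cinf_c n X At"
      using b(4,6) by (auto simp: Cinf_c_iff g_def)
    then have g: "g \<in> car (C0 X)" by (rule C)
    have pos: "nrm ?A g > 0"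
      using C0_nrm_ge[OF g p] b(3) C0_abs_nrm[OF nonempty g] by (simp add: g_def)
    have "(\<lambda>x. 0, g) \<in> car (\<A> 1)"
      using zero g by (simp add: \<A>_simps vanishing_summand_def direct_sum_def)
    with dense have "\<forall>\<epsilon>>0. \<exists>y\<in>restrict (\<pi> 1) B ` B. nrm (\<A> 1) (sub (\<A> 1) (\<lambda>x. 0, g) y) < \<epsilon>"
      unfolding dense_in_def by (elim conjE) (rule bspec)
    with pos obtain y where y: "y \<in> restrict (\<pi> 1) B ` B" "nrm (\<A> 1) (sub (\<A> 1) (\<lambda>x. 0, g) y) < nrm ?A g"
      by (elim allE[of _ "nrm ?A g"] impE bexE)
    from y(1) have "snd y = (\<lambda>x. 0)" by (auto simp: \<pi>_def)
    with y(2) show False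
      unfolding \<A>_simps direct_sum_sub by (simp add: direct_sum_def)
  qed
  then have "\<not> (\<exists>B. B \<subseteq> Cinf_c n X At \<and> dense_star_subalgebra (C0 X) B \<and>
      strict_deformation_quantization n X At (\<lambda>f g x. 0) {0..1} \<A> \<Gamma> B (\<lambda>h. restrict (\<pi> h) B))"
    using strict_deformation_quantization.quant_image[of _ _ _ _ "{0..1}" _ _ _ _ 1] by fastforce
  with quantization show ?thesis by blast
qed

end
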